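(* Let $F_n$ be the free group of finite rank $n$ and let $H\le F_n$ be a profinitely characteristic finite-index subgroup (for instance, any finite-index verbal subgroup of $F_n$ is such). If $L\le F_n$ is finitely generated and measure equivalent to $H$, then $L=H$. In particular $H$ is setwise profinitely rigid in $F_n$.
   Context: A finite-index subgroup $H\le F_n$ is profinitely characteristic if $\Theta(\overline H)=\overline H$ for every continuous automorphism $\Theta$ of the profinite completion $\widehat{F_n}$, where $\overline H$ is the closure of $H$ in $\widehat{F_n}$. A verbal subgroup of $F_n$ is a subgroup $V(F_n)$ generated by all values in $F_n$ of the words in some set of words $V$. For a finite group $K$, a finitely generated $H\le F_n$ and $h\in\mathrm{Hom}(H,K)$, put $\Pr_{H,K}(h)=|\{f\in\mathrm{Hom}(F_n,K): f|_H=h\}|/|\mathrm{Hom}(F_n,K)|$. Finitely generated subgroups $H,L\le F_n$ are measure equivalent if there is an isomorphism $\alpha\colon H\to L$ with $\Pr_{L,K}(h)=\Pr_{H,K}(h\circ\alpha)$ for every finite group $K$ and every $h\in\mathrm{Hom}(L,K)$. $H$ is setwise profinitely rigid in $F_n$ if every finitely generated $L\le F_n$ measure equivalent to $H$ is of the form $L=\varphi(H)$ for some $\varphi\in\mathrm{Aut}(F_n)$. *)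

theory Defs
  imports "HOL-Analysis.Analysis" "HOL-Algebra.Generated_Groups" "HOL-Algebra.Product_Groups"
begin

section \<open>Free groups\<close>

text \<open>The letter \<open>(x, True)\<close> stands for the generator \<open>x\<close>, and \<open>(x, False)\<close> for its inverse.
  The elements of the free group are the reduced words.\<close>

definition letter_inv :: "'a \<times> bool \<Rightarrow> 'a \<times> bool" where
  "letter_inv a = (fst a, \<not> snd a)"

definition reduced_word :: "('a \<times> bool) list \<Rightarrow> bool" where
  "reduced_word = successively (\<lambda>a b. b \<noteq> letter_inv a)"

fun push :: "'a \<times> bool \<Rightarrow> ('a \<times> bool) list \<Rightarrow> ('a \<times> bool) list" where
  "push a [] = [a]"
| "push a (b # w) = (if b = letter_inv a then w else a # b # w)"

definition free_group :: "'a set \<Rightarrow> ('a \<times> bool) list monoid" where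
  "free_group X =
     \<lparr>carrier = {w. reduced_word w \<and> fst ` set w \<subseteq> X}, mult = (\<lambda>u v. foldr push u v), one = []\<rparr>"

abbreviation free_group_rank :: "nat \<Rightarrow> (nat \<times> bool) list monoid" where
  "free_group_rank n \<equiv> free_group {..<n}"

lemma letter_inv_inv [simp]: "letter_inv (letter_inv a) = a"
  by (simp add: letter_inv_def)

lemma letter_inv_neq [simp]: "letter_inv a \<noteq> a" "a \<noteq> letter_inv a"
  by (auto simp: letter_inv_def prod_eq_iff)

lemma reduced_word_simps [simp]:
  "reduced_word []" "reduced_word [a]"
  "reduced_word (a # b # w) \<longleftrightarrow> b \<noteq> letter_inv a \<and> reduced_word (b # w)"
  by (simp_all add: reduced_word_def)

lemma reduced_tl: "reduced_word (a # w) \<Longrightarrow> reduced_word w"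
  by (cases w) auto

lemma reduced_push: "reduced_word w \<Longrightarrow> reduced_word (push a w)"
  by (cases w) (auto dest: reduced_tl)

lemma reduced_foldr_push: "reduced_word w \<Longrightarrow> reduced_word (foldr push u w)"
  by (induction u) (auto intro: reduced_push)

lemma push_reduced: "reduced_word (a # w) \<Longrightarrow> push a w = a # w"
  by (cases w) auto

lemma push_push_inv: "reduced_word w \<Longrightarrow> push a (push (letter_inv a) w) = w"
  by (cases w) (auto simp: push_reduced)

lemma set_push: "set (push a w) \<subseteq> insert a (set w)"
  by (cases w) auto

lemma set_foldr_push: "set (foldr push u w) \<subseteq> set u \<union> set w"
proof (induction u)
  case (Cons a u)
  then show ?case using set_push[of a "foldr push u w"] by auto
qed simp

lemma foldr_push_push: "reduced_word w \<Longrightarrow> foldr push (push a v) w = push a (foldr push v w)"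
proof (cases v)
  case (Cons b v')
  assume "reduced_word w"
  then have "reduced_word (foldr push v' w)" by (rule reduced_foldr_push)
  with Cons show ?thesis by (auto simp: push_push_inv)
qed simp

lemma foldr_push_assoc:
  "reduced_word w \<Longrightarrow> foldr push (foldr push u v) w = foldr push u (foldr push v w)"
  by (induction u) (simp_all add: foldr_push_push)

lemma foldr_push_Nil: "reduced_word u \<Longrightarrow> foldr push u [] = u"
proof (induction u)
  case (Cons a u)
  then show ?case using push_reduced[of a u] reduced_tl[of a u] by simp
qed simp

lemma foldr_push_inverse:
  "reduced_word w \<Longrightarrow> foldr push (map letter_inv (rev u)) (foldr push u w) = w"
proof (induction u arbitrary: w)
  case (Cons a u)
  have "push (letter_inv a) (push a (foldr push u w)) = foldr push u w"
    using push_push_inv[of "foldr push u w" "letter_inv a"] Cons.prems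
    by (simp add: reduced_foldr_push)
  with Cons show ?case by simp
qed simp

lemma reduced_inverse: "reduced_word u \<Longrightarrow> reduced_word (map letter_inv (rev u))"
  unfolding reduced_word_def successively_map successively_rev
  by (erule successively_mono) (metis letter_inv_inv)

lemma group_free_group: "group (free_group X)"
proof (rule groupI)
  fix u v assume "u \<in> carrier (free_group X)" "v \<in> carrier (free_group X)"
  then show "u \<otimes>\<^bsub>free_group X\<^esub> v \<in> carrier (free_group X)"
    using subset_trans[OF image_mono[OF set_foldr_push[of u v], of fst], of X]
    by (simp add: free_group_def reduced_foldr_push image_Un)
next
  fix u assume u: "u \<in> carrier (free_group X)"
  have "foldr push (map letter_inv (rev u)) u = []"
    using u foldr_push_inverse[of "[]" u] by (simp add: free_group_def foldr_push_Nil)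
  moreover have "map letter_inv (rev u) \<in> carrier (free_group X)"
    using u by (auto simp: free_group_def reduced_inverse letter_inv_def)
  ultimately show "\<exists>v\<in>carrier (free_group X). v \<otimes>\<^bsub>free_group X\<^esub> u = \<one>\<^bsub>free_group X\<^esub>"
    by (intro bexI[of _ "map letter_inv (rev u)"]) (simp_all add: free_group_def)
qed (auto simp: free_group_def foldr_push_assoc)

lemma free_group_universal:
  assumes "group K" "f \<in> X \<rightarrow> carrier K"
  shows "\<exists>!h. h \<in> hom (free_group X) K \<inter> extensional (carrier (free_group X)) \<and>
              (\<forall>x\<in>X. h [(x, True)] = f x)"
proof -
  interpret K: group K by fact
  interpret F: group "free_group X" by (rule group_free_group)
  define l where "l = (\<lambda>a. if snd a then f (fst a) else inv\<^bsub>K\<^esub> f (fst a))"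
  define e where "e = (\<lambda>w. foldr (\<lambda>a r. l a \<otimes>\<^bsub>K\<^esub> r) w \<one>\<^bsub>K\<^esub>)"
  have l: "l a \<in> carrier K" if "fst a \<in> X" for a
    using that assms(2) by (auto simp: l_def)
  have l_inv: "l a \<otimes>\<^bsub>K\<^esub> l (letter_inv a) = \<one>\<^bsub>K\<^esub>" if "fst a \<in> X" for a
    using that K.r_inv[of "f (fst a)"] K.l_inv[of "f (fst a)"] funcset_mem[OF assms(2) that]
    by (cases "snd a") (simp_all add: l_def letter_inv_def)
  have e: "e w \<in> carrier K" if "fst ` set w \<subseteq> X" for w
    using that by (induction w) (auto simp: e_def l)
  have push: "e (push a w) = l a \<otimes>\<^bsub>K\<^esub> e w" if "fst a \<in> X" "fst ` set w \<subseteq> X" for a w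
  proof (cases w)
    case (Cons b v)
    have "l a \<otimes>\<^bsub>K\<^esub> (l (letter_inv a) \<otimes>\<^bsub>K\<^esub> e v) = e v"
      using that l[of a] l[of "letter_inv a"] e[of v] Cons l_inv[of a]
      by (simp add: K.m_assoc[symmetric] letter_inv_def)
    with Cons show ?thesis by (auto simp: e_def)
  qed (simp add: e_def)
  have mult: "e (foldr push u v) = e u \<otimes>\<^bsub>K\<^esub> e v" if "fst ` set u \<subseteq> X" "fst ` set v \<subseteq> X" for u v
    using that(1)
  proof (induction u)
    case Nil
    then show ?case using e[OF that(2)] by (simp add: e_def)
  next
    case (Cons a u)
    have "fst ` set (foldr push u v) \<subseteq> X"
      using Cons.prems that(2) set_foldr_push[of u v] by fastforce
    then have "e (foldr push (a # u) v) = l a \<otimes>\<^bsub>K\<^esub> (e u \<otimes>\<^bsub>K\<^esub> e v)"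
      using Cons push by simp
    also have "\<dots> = e (a # u) \<otimes>\<^bsub>K\<^esub> e v"
      using Cons.prems l[of a] e[of u] e[OF that(2)] by (simp add: e_def K.m_assoc)
    finally show ?case .
  qed
  let ?C = "carrier (free_group X)"
  have "restrict e ?C \<in> hom (free_group X) K \<inter> extensional ?C"
    using F.m_closed mult e by (auto simp: hom_def free_group_def)
  moreover have "restrict e ?C [(x, True)] = f x" if "x \<in> X" for x
    using that funcset_mem[OF assms(2) that] by (simp add: free_group_def e_def l_def)
  moreover have "h = h'"
    if h: "h \<in> hom (free_group X) K \<inter> extensional ?C" "\<forall>x\<in>X. h [(x, True)] = f x"
      and h': "h' \<in> hom (free_group X) K \<inter> extensional ?C" "\<forall>x\<in>X. h' [(x, True)] = f x" for h h'
  proof -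
    interpret h: group_hom "free_group X" K h using h by unfold_locales auto
    interpret h': group_hom "free_group X" K h' using h' by unfold_locales auto
    have letter: "h [a] = h' [a]" if "fst a \<in> X" for a
    proof (cases "snd a")
      case True
      then show ?thesis using that h(2) h'(2) by (cases a) auto
    next
      case False
      have gen: "[(fst a, True)] \<in> ?C" and a: "[a] \<in> ?C"
        using that by (auto simp: free_group_def)
      have "[a] \<otimes>\<^bsub>free_group X\<^esub> [(fst a, True)] = \<one>\<^bsub>free_group X\<^esub>"
        using False by (cases a) (auto simp: free_group_def letter_inv_def)
      then have "[a] = inv\<^bsub>free_group X\<^esub> [(fst a, True)]"
        using gen a F.inv_equality by force
      then show ?thesis using gen h(2) h'(2) that by simp
    qed
    have "h w = h' w" if "w \<in> ?C" for w
      using that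
    proof (induction w)
      case Nil
      then show ?case using h.hom_one h'.hom_one by (simp add: free_group_def)
    next
      case (Cons a w)
      have w: "w \<in> ?C" and a: "[a] \<in> ?C" "fst a \<in> X"
        using Cons.prems by (auto simp: free_group_def dest: reduced_tl)
      have "a # w = [a] \<otimes>\<^bsub>free_group X\<^esub> w"
        using Cons.prems by (simp add: free_group_def push_reduced)
      then show ?case using w a Cons.IH letter by simp
    qed
    then show ?thesis using h(1) h'(1) by (auto intro: extensionalityI)
  qed
  ultimately show ?thesis by blast
qed

section \<open>Subgroups\<close>

definition finite_index :: "('a, 'b) monoid_scheme \<Rightarrow> 'a set \<Rightarrow> bool" where
  "finite_index G H \<longleftrightarrow> finite (rcosets\<^bsub>G\<^esub> H)"

definition finitely_generated :: "('a, 'b) monoid_scheme \<Rightarrow> 'a set \<Rightarrow> bool" where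
  "finitely_generated G H \<longleftrightarrow> (\<exists>S. finite S \<and> S \<subseteq> carrier G \<and> H = generate G S)"

text \<open>Words are elements of the free group on countably many letters; a value of a word in \<open>G\<close>
  is its image under a homomorphism to \<open>G\<close>, that is, under a substitution of elements of \<open>G\<close>
  for the letters.\<close>

definition verbal_subgroup :: "('a, 'b) monoid_scheme \<Rightarrow> (nat \<times> bool) list set \<Rightarrow> 'a set" where
  "verbal_subgroup G V =
     generate G {h w | h w. h \<in> hom (free_group (UNIV :: nat set)) G \<and> w \<in> V}"

definition is_verbal :: "('a, 'b) monoid_scheme \<Rightarrow> 'a set \<Rightarrow> bool" where
  "is_verbal G H \<longleftrightarrow>
     (\<exists>V \<subseteq> carrier (free_group (UNIV :: nat set)). H = verbal_subgroup G V)"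

section \<open>The profinite completion\<close>

definition fin_quotients :: "('a, 'b) monoid_scheme \<Rightarrow> 'a set set" where
  "fin_quotients G = {N. N \<lhd> G \<and> finite_index G N}"

text \<open>The inverse limit of the quotients \<open>G Mod N\<close> with \<open>N\<close> normal of finite index. For
  \<open>N \<subseteq> M\<close> the transition map \<open>G Mod N \<rightarrow> G Mod M\<close> sends a coset \<open>C\<close> to
  \<open>C <#>\<^bsub>G\<^esub> M\<close>, which maps \<open>N #>\<^bsub>G\<^esub> g\<close> to \<open>M #>\<^bsub>G\<^esub> g\<close>.\<close>

definition profinite_completion :: "('a, 'b) monoid_scheme \<Rightarrow> ('a set \<Rightarrow> 'a set) monoid" where
  "profinite_completion G =
     (product_group (fin_quotients G) (\<lambda>N. G Mod N))
       \<lparr>carrier := {x \<in> (\<Pi>\<^sub>E N\<in>fin_quotients G. carrier (G Mod N)).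
          \<forall>N\<in>fin_quotients G. \<forall>M\<in>fin_quotients G. N \<subseteq> M \<longrightarrow> x N <#>\<^bsub>G\<^esub> M = x M}\<rparr>"

definition profinite_topology :: "('a, 'b) monoid_scheme \<Rightarrow> ('a set \<Rightarrow> 'a set) topology" where
  "profinite_topology G =
     subtopology
       (product_topology (\<lambda>N. discrete_topology (carrier (G Mod N))) (fin_quotients G))
       (carrier (profinite_completion G))"

definition profinite_map :: "('a, 'b) monoid_scheme \<Rightarrow> 'a \<Rightarrow> ('a set \<Rightarrow> 'a set)" where
  "profinite_map G g = (\<lambda>N\<in>fin_quotients G. N #>\<^bsub>G\<^esub> g)"

definition profinite_closure :: "('a, 'b) monoid_scheme \<Rightarrow> 'a set \<Rightarrow> ('a set \<Rightarrow> 'a set) set" where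
  "profinite_closure G H = profinite_topology G closure_of (profinite_map G ` H)"

definition continuous_aut :: "('a, 'b) monoid_scheme \<Rightarrow> (('a set \<Rightarrow> 'a set) \<Rightarrow> ('a set \<Rightarrow> 'a set)) set"
  where
  "continuous_aut G =
     {\<Theta> \<in> iso (profinite_completion G) (profinite_completion G).
        continuous_map (profinite_topology G) (profinite_topology G) \<Theta>}"

definition profinitely_characteristic :: "('a, 'b) monoid_scheme \<Rightarrow> 'a set \<Rightarrow> bool" where
  "profinitely_characteristic G H \<longleftrightarrow>
     subgroup H G \<and> finite_index G H \<and>
     (\<forall>\<Theta>\<in>continuous_aut G. \<Theta> ` profinite_closure G H = profinite_closure G H)"

section \<open>Measure equivalence\<close>

text \<open>Homomorphisms are made extensional (\<open>undefined\<close> outside the carrier), so that they can be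
  counted and compared as functions.\<close>

definition Hom :: "('a, 'c) monoid_scheme \<Rightarrow> ('b, 'd) monoid_scheme \<Rightarrow> ('a \<Rightarrow> 'b) set" where
  "Hom G K = hom G K \<inter> extensional (carrier G)"

definition Pr_hom :: "('a, 'c) monoid_scheme \<Rightarrow> 'a set \<Rightarrow> ('b, 'd) monoid_scheme \<Rightarrow> ('a \<Rightarrow> 'b) \<Rightarrow> real"
  where
  "Pr_hom G H K h = real (card {f \<in> Hom G K. restrict f H = h}) / real (card (Hom G K))"

text \<open>HOL cannot quantify over all finite groups inside a definition. Every finite group is
  isomorphic to one whose elements are natural numbers, so it suffices to let \<open>K\<close> range over
  those; \<open>measure_equivalent_via_finite\<close> below recovers arbitrary finite groups.\<close>

definition measure_equivalent_via ::
    "('a, 'b) monoid_scheme \<Rightarrow> 'a set \<Rightarrow> 'a set \<Rightarrow> ('a \<Rightarrow> 'a) \<Rightarrow> bool" where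
  "measure_equivalent_via G H L \<alpha> \<longleftrightarrow>
     \<alpha> \<in> iso (G\<lparr>carrier := H\<rparr>) (G\<lparr>carrier := L\<rparr>) \<and>
     (\<forall>K :: nat monoid. group K \<and> finite (carrier K) \<longrightarrow>
        (\<forall>h\<in>Hom (G\<lparr>carrier := L\<rparr>) K. Pr_hom G L K h = Pr_hom G H K (compose H h \<alpha>)))"

definition measure_equivalent :: "('a, 'b) monoid_scheme \<Rightarrow> 'a set \<Rightarrow> 'a set \<Rightarrow> bool" where
  "measure_equivalent G H L \<longleftrightarrow> (\<exists>\<alpha>. measure_equivalent_via G H L \<alpha>)"

lemma Hom_compose_bij:
  assumes K: "group K" and \<phi>: "\<phi> \<in> iso K K'" and G: "group G"
  shows "bij_betw (compose (carrier G) \<phi>) (Hom G K) (Hom G K')"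
proof -
  have \<psi>: "inv_into (carrier K) \<phi> \<in> iso K' K"
    using K \<phi> by (rule group.iso_set_sym)
  have bij: "bij_betw \<phi> (carrier K) (carrier K')"
    using \<phi> by (simp add: iso_def)
  have inv1: "inv_into (carrier K) \<phi> (\<phi> x) = x" if "x \<in> carrier K" for x
    using bij that by (simp add: bij_betw_def)
  have inv2: "\<phi> (inv_into (carrier K) \<phi> y) = y" if "y \<in> carrier K'" for y
    using bij that by (simp add: bij_betw_inv_into_right)
  have m: "\<And>x y. x \<in> carrier G \<Longrightarrow> y \<in> carrier G \<Longrightarrow> x \<otimes>\<^bsub>G\<^esub> y \<in> carrier G"
    using G by (simp add: group.is_monoid monoid.m_closed)
  show ?thesis
  proof (rule bij_betw_byWitness[where f' = "compose (carrier G) (inv_into (carrier K) \<phi>)"])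
    show "\<forall>h\<in>Hom G K. compose (carrier G) (inv_into (carrier K) \<phi>) (compose (carrier G) \<phi> h) = h"
      by (auto simp: Hom_def hom_def compose_def inv1 Pi_iff intro!: extensionalityI[where A = "carrier G"])
    show "\<forall>h\<in>Hom G K'. compose (carrier G) \<phi> (compose (carrier G) (inv_into (carrier K) \<phi>) h) = h"
      by (auto simp: Hom_def hom_def compose_def inv2 Pi_iff intro!: extensionalityI[where A = "carrier G"])
    show "compose (carrier G) \<phi> ` Hom G K \<subseteq> Hom G K'"
      using \<phi> m by (auto simp: Hom_def hom_def iso_def compose_def Pi_iff)
    show "compose (carrier G) (inv_into (carrier K) \<phi>) ` Hom G K' \<subseteq> Hom G K"
      using \<psi> m by (auto simp: Hom_def hom_def iso_def compose_def Pi_iff)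
  qed
qed

lemma Pr_hom_iso:
  assumes "group G" "group K" "\<phi> \<in> iso K K'" "H \<subseteq> carrier G"
    and h: "h \<in> H \<rightarrow> carrier K" "h \<in> extensional H"
  shows "Pr_hom G H K' (compose H \<phi> h) = Pr_hom G H K h"
proof -
  let ?c = "compose (carrier G) \<phi>"
  have bij: "bij_betw ?c (Hom G K) (Hom G K')"
    using assms by (intro Hom_compose_bij)
  have inj: "inj_on \<phi> (carrier K)"
    using assms(3) by (simp add: iso_def bij_betw_def)
  have eq: "restrict (?c f) H = compose H \<phi> h \<longleftrightarrow> restrict f H = h" if "f \<in> Hom G K" for f
  proof
    assume *: "restrict (?c f) H = compose H \<phi> h"
    show "restrict f H = h"
    proof (rule extensionalityI[where A = H])
      fix x assume x: "x \<in> H"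
      then have "\<phi> (f x) = \<phi> (h x)"
        using fun_cong[OF *, of x] assms(4) by (simp add: compose_def subset_iff)
      moreover have "f x \<in> carrier K" "h x \<in> carrier K"
        using x that h assms(4) by (auto simp: Hom_def hom_def)
      ultimately show "restrict f H x = h x" using inj x by (auto simp: inj_on_def)
    qed (use h in auto)
  next
    assume *: "restrict f H = h"
    have "\<phi> (f x) = \<phi> (h x)" if "x \<in> H" for x
      using fun_cong[OF *, of x] that by simp
    then show "restrict (?c f) H = compose H \<phi> h"
      using assms(4) by (intro ext) (simp add: compose_def restrict_def subset_iff)
  qed
  have "bij_betw ?c {f \<in> Hom G K. restrict f H = h} {f \<in> Hom G K'. restrict f H = compose H \<phi> h}"
  proof (rule bij_betw_subset[OF bij])
    have im: "?c ` Hom G K = Hom G K'"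
      using bij by (simp add: bij_betw_def)
    show "?c ` {f \<in> Hom G K. restrict f H = h} = {f \<in> Hom G K'. restrict f H = compose H \<phi> h}"
    proof (intro equalityI subsetI)
      fix g assume g: "g \<in> {f \<in> Hom G K'. restrict f H = compose H \<phi> h}"
      then obtain f where "f \<in> Hom G K" "g = ?c f" using im by blast
      with g eq show "g \<in> ?c ` {f \<in> Hom G K. restrict f H = h}" by blast
    qed (use im eq in blast)
  qed blast
  with bij show ?thesis
    by (simp add: Pr_hom_def bij_betw_same_card)
qed

lemma measure_equivalent_via_finite:
  fixes K :: "('k, 'm) monoid_scheme"
  assumes G: "group G" "subgroup H G" "subgroup L G" and me: "measure_equivalent_via G H L \<alpha>"
    and K: "group K" "finite (carrier K)" and h: "h \<in> Hom (G\<lparr>carrier := L\<rparr>) K"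
  shows "Pr_hom G L K h = Pr_hom G H K (compose H h \<alpha>)"
proof -
  interpret K: group K by fact
  obtain \<phi> :: "'k \<Rightarrow> nat" where inj: "inj_on \<phi> (carrier K)"
    using K(2) finite_imp_inj_to_nat_seg by blast
  let ?\<psi> = "inv_into (carrier K) \<phi>"
  define K' where "K' = \<lparr>carrier = \<phi> ` carrier K,
    mult = (\<lambda>x y. \<phi> (?\<psi> x \<otimes>\<^bsub>K\<^esub> ?\<psi> y)), one = \<phi> \<one>\<^bsub>K\<^esub>\<rparr>"
  have \<phi>: "\<phi> \<in> iso K K'"
    using inj by (auto simp: iso_def hom_def K'_def bij_betw_def)
  have K'_monoid: "monoid K'"
    using inj by (unfold_locales) (auto simp: K'_def K.m_assoc)
  then have K': "group K'"
    using \<phi> by (metis K.iso_imp_group is_isoI)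
  have sub: "H \<subseteq> carrier G" "L \<subseteq> carrier G"
    using G by (auto dest: subgroup.subset)
  have h1: "h \<in> L \<rightarrow> carrier K" "h \<in> extensional L"
    using h by (auto simp: Hom_def hom_def)
  have \<alpha>: "\<alpha> \<in> H \<rightarrow> L"
    using me by (auto simp: measure_equivalent_via_def iso_def hom_def)
  have "compose L \<phi> h \<in> Hom (G\<lparr>carrier := L\<rparr>) K'"
    using h \<phi> subgroup.m_closed[OF G(3)] by (auto simp: Hom_def hom_def iso_def compose_def Pi_iff)
  then have "Pr_hom G L K' (compose L \<phi> h) = Pr_hom G H K' (compose H (compose L \<phi> h) \<alpha>)"
    using me K' K(2) by (auto simp: measure_equivalent_via_def K'_def)
  moreover have "compose H (compose L \<phi> h) \<alpha> = compose H \<phi> (compose H h \<alpha>)"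
    using \<alpha> by (auto simp: compose_def fun_eq_iff)
  moreover have "compose H h \<alpha> \<in> H \<rightarrow> carrier K" "compose H h \<alpha> \<in> extensional H"
    using h1 \<alpha> by (auto simp: compose_def)
  ultimately show ?thesis
    using Pr_hom_iso[OF G(1) K(1) \<phi> sub(2) h1] Pr_hom_iso[OF G(1) K(1) \<phi> sub(1), of "compose H h \<alpha>"]
    by simp
qed

definition setwise_profinitely_rigid :: "('a, 'b) monoid_scheme \<Rightarrow> 'a set \<Rightarrow> bool" where
  "setwise_profinitely_rigid G H \<longleftrightarrow>
     (\<forall>L. subgroup L G \<and> finitely_generated G L \<and> measure_equivalent G H L \<longrightarrow>
        (\<exists>\<phi>\<in>iso G G. L = \<phi> ` H))"

end

theory Submission
  imports Defs "HOL-Algebra.Bij"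
begin

text \<open>Let \<open>F\<close> be a free group of finite rank, \<open>H\<close> a profinitely characteristic subgroup of finite index,
  and \<open>\<alpha>\<close> an isomorphism from \<open>H\<close> to \<open>L\<close> that witnesses measure equivalence.

  The heart of the proof is that \<open>\<alpha>\<close> extends to a continuous automorphism of the profinite completion
  of \<open>F\<close>. For a finite quotient \<open>Q\<close> of \<open>F\<close>, measure equivalence says that a homomorphism
  from \<open>L\<close> to \<open>Q\<close> has as many extensions to \<open>F\<close> as its pullback along \<open>\<alpha>\<close>. The same holds with \<open>Q\<close>
  replaced by its subgroups, hence also for the numbers of surjective extensions. Thus the
  projection of \<open>F\<close> to \<open>Q\<close> can be replaced by an epimorphism that takes the same value on each \<open>x\<close>
  in \<open>H\<close> as the projection does on \<open>\<alpha> x\<close> (\<open>transfer_epimorphism\<close>). As \<open>F\<close> is free, this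
  epimorphism lifts to an endomorphism of \<open>F\<close>. Along a cofinal chain of fully invariant subgroups
  of finite index (\<open>perm_level\<close>), compactness selects a coherent sequence of such endomorphisms
  (\<open>measure_equivalent_coherent\<close>), and its limit is the automorphism wanted
  (\<open>limit_map_continuous_aut\<close>).

  This automorphism maps the closure of \<open>H\<close> onto the closure of \<open>L\<close>, and it preserves the closure
  of \<open>H\<close>. So \<open>H\<close> and \<open>L\<close> have the same closure. Both are closed in the profinite topology of \<open>F\<close>,
  \<open>H\<close> as a subgroup of finite index and \<open>L\<close> as a finitely generated subgroup, by a theorem of M. Hall
  (\<open>perm_level_separates_finitely_generated\<close>). Hence \<open>L = H\<close>.

  A verbal subgroup \<open>H\<close> of finite index is killed by every homomorphism from \<open>F\<close> to \<open>F Mod H\<close>,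
  because values of words go to values of words. In particular it is killed by the homomorphism
  induced by a continuous automorphism, which therefore maps the closure of \<open>H\<close> into itself. As
  \<open>F Mod H\<close> is finite, the closure is mapped onto itself
  (\<open>verbal_profinitely_characteristic\<close>).\<close>

section \<open>Closures in the profinite completion\<close>

lemma fin_quotientsD:
  assumes "N \<in> fin_quotients G"
  shows "N \<lhd> G" "subgroup N G" "finite (rcosets\<^bsub>G\<^esub> N)"
  using assms by (auto simp: fin_quotients_def finite_index_def normal_imp_subgroup)

context group
begin

lemma rcos_eq_iff:
  assumes "subgroup N G" "a \<in> carrier G" "b \<in> carrier G"
  shows "N #> a = N #> b \<longleftrightarrow> a \<otimes> inv b \<in> N"
  using assms repr_independence repr_independenceD subgroup.rcos_module[OF assms(1) is_group]
  by metis

lemma rcos_eq_mono: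
  assumes "N \<subseteq> M" "subgroup N G" "subgroup M G" "a \<in> carrier G" "b \<in> carrier G"
    and "N #> a = N #> b"
  shows "M #> a = M #> b"
  using assms by (auto simp: rcos_eq_iff)

lemma r_coset_Int:
  assumes "N \<subseteq> carrier G" "M \<subseteq> carrier G" "g \<in> carrier G"
  shows "(N \<inter> M) #> g = (N #> g) \<inter> (M #> g)"
proof -
  have "n = m" if "n \<in> N" "m \<in> M" "n \<otimes> g = m \<otimes> g" for n m
    using that assms by (auto simp: subset_iff)
  then show ?thesis by (fastforce simp: r_coset_def)
qed

lemma finite_index_Int:
  assumes "finite_index G N" "finite_index G M" "N \<subseteq> carrier G" "M \<subseteq> carrier G"
  shows "finite_index G (N \<inter> M)"
proof -
  have "rcosets (N \<inter> M) \<subseteq> (\<lambda>(A, B). A \<inter> B) ` ((rcosets N) \<times> (rcosets M))"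
    using assms(3,4) by (fastforce simp: RCOSETS_def r_coset_Int)
  then show ?thesis
    using assms(1,2) unfolding finite_index_def by (meson finite_SigmaI finite_imageI finite_subset)
qed

lemma fin_quotients_Int:
  assumes "N \<in> fin_quotients G" "M \<in> fin_quotients G"
  shows "N \<inter> M \<in> fin_quotients G"
  using assms
  by (auto simp: fin_quotients_def normal_subgroup_intersect finite_index_Int
      normal_imp_subgroup subgroup.subset)

lemma carrier_fin_quotient: "carrier G \<in> fin_quotients G"
proof -
  have "rcosets (carrier G) \<subseteq> {carrier G}"
    using coset_join2 subgroup_self by (auto simp: RCOSETS_def)
  then have "finite_index G (carrier G)"
    unfolding finite_index_def using finite_subset by blast
  moreover have "carrier G \<lhd> G"
    by (rule normalI) (auto simp: subgroup_self coset_join2 coset_join3)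
  ultimately show ?thesis by (simp add: fin_quotients_def)
qed

lemma fin_quotients_Inter:
  assumes "finite \<N>" "\<N> \<subseteq> fin_quotients G"
  shows "carrier G \<inter> \<Inter>\<N> \<in> fin_quotients G"
  using assms
proof (induction rule: finite_induct)
  case empty
  then show ?case by (simp add: carrier_fin_quotient)
next
  case (insert N \<N>)
  have "carrier G \<inter> \<Inter>(insert N \<N>) = N \<inter> (carrier G \<inter> \<Inter>\<N>)" by blast
  with insert show ?case by (simp add: fin_quotients_Int)
qed

lemma kernel_fin_quotient:
  assumes "group K" "finite (carrier K)" "\<phi> \<in> hom G K"
  shows "kernel G K \<phi> \<in> fin_quotients G"
proof -
  interpret K: group K by fact
  interpret \<phi>: group_hom G K \<phi> using assms by unfold_locales auto
  have "kernel G K \<phi> #> g = {x \<in> carrier G. \<phi> x = \<phi> g}" (is "?l = ?r") if g: "g \<in> carrier G" for g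
  proof
    show "?l \<subseteq> ?r" using g by (auto simp: r_coset_def kernel_def)
    show "?r \<subseteq> ?l"
    proof
      fix x assume x: "x \<in> ?r"
      then have "x \<otimes> inv g \<in> kernel G K \<phi>" using g by (auto simp: kernel_def)
      then show "x \<in> ?l"
        using subgroup.rcos_module[OF \<phi>.subgroup_kernel is_group] g x by auto
    qed
  qed
  then have "rcosets (kernel G K \<phi>) \<subseteq> (\<lambda>c. {x \<in> carrier G. \<phi> x = c}) ` carrier K"
    by (auto simp: RCOSETS_def)
  then have "finite_index G (kernel G K \<phi>)"
    unfolding finite_index_def using assms(2) finite_surj by blast
  then show ?thesis by (simp add: fin_quotients_def \<phi>.normal_kernel)
qed

lemma rcos_mult_supergroup:
  assumes "N \<subseteq> M" "subgroup N G" "M \<lhd> G" "g \<in> carrier G"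
  shows "(N #> g) <#> M = M #> g"
proof -
  interpret M: normal M G by fact
  have N: "N \<subseteq> carrier G" using assms by (simp add: subgroup.subset)
  have "N <#> M = M"
  proof
    show "N <#> M \<subseteq> M" using assms(1) by (auto simp: set_mult_def)
    show "M \<subseteq> N <#> M"
      using subgroup.one_closed[OF assms(2)] by (force simp: set_mult_def)
  qed
  moreover have "(N #> g) <#> M = N <#> (M #> g)"
    using N assms(4) M.subset M.coset_eq by (simp add: rcos_assoc_lcos)
  ultimately show ?thesis
    using N assms(4) M.subset by (simp add: setmult_rcos_assoc)
qed

lemma profinite_completion_coset:
  assumes "x \<in> carrier (profinite_completion G)" "N \<in> fin_quotients G"
  obtains g where "g \<in> carrier G" "x N = N #> g"
  using assms by (fastforce simp: profinite_completion_def carrier_FactGroup PiE_iff)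

lemma profinite_completion_mono:
  assumes "x \<in> carrier (profinite_completion G)" "N \<in> fin_quotients G" "M \<in> fin_quotients G"
    and "N \<subseteq> M" "g \<in> carrier G" "x N = N #> g"
  shows "x M = M #> g"
proof -
  have "x M = x N <#> M"
    using assms by (auto simp: profinite_completion_def)
  then show ?thesis
    using assms rcos_mult_supergroup fin_quotientsD by metis
qed

lemma profinite_completionI:
  assumes "x \<in> extensional (fin_quotients G)"
    and "\<And>N M. N \<in> fin_quotients G \<Longrightarrow> M \<in> fin_quotients G \<Longrightarrow> N \<subseteq> M \<Longrightarrow>
           \<exists>g\<in>carrier G. x N = N #> g \<and> x M = M #> g"
  shows "x \<in> carrier (profinite_completion G)"
proof -
  have "x N <#> M = x M"
    if "N \<in> fin_quotients G" "M \<in> fin_quotients G" "N \<subseteq> M" for N M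
    using assms(2)[OF that] rcos_mult_supergroup[OF that(3)] fin_quotientsD that by metis
  moreover have "x N \<in> carrier (G Mod N)" if "N \<in> fin_quotients G" for N
    using assms(2)[OF that that] by (auto simp: carrier_FactGroup)
  ultimately show ?thesis
    using assms(1) by (auto simp: profinite_completion_def PiE_iff)
qed

lemma profinite_completion_eqI:
  assumes "x \<in> carrier (profinite_completion G)" "y \<in> carrier (profinite_completion G)"
    and "\<And>N. N \<in> fin_quotients G \<Longrightarrow> x N = y N"
  shows "x = y"
  using assms by (auto simp: profinite_completion_def intro: PiE_ext)

lemma profinite_completion_mult:
  assumes "N \<in> fin_quotients G"
  shows "(x \<otimes>\<^bsub>profinite_completion G\<^esub> y) N = x N <#> y N"
  using assms by (simp add: profinite_completion_def)

lemma profinite_completion_m_closed: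
  assumes x: "x \<in> carrier (profinite_completion G)" and y: "y \<in> carrier (profinite_completion G)"
  shows "x \<otimes>\<^bsub>profinite_completion G\<^esub> y \<in> carrier (profinite_completion G)"
proof (rule profinite_completionI)
  fix N M assume NM: "N \<in> fin_quotients G" "M \<in> fin_quotients G" "N \<subseteq> M"
  obtain a where a: "a \<in> carrier G" "x N = N #> a" using profinite_completion_coset[OF x NM(1)] .
  obtain b where b: "b \<in> carrier G" "y N = N #> b" using profinite_completion_coset[OF y NM(1)] .
  have "(x \<otimes>\<^bsub>profinite_completion G\<^esub> y) N = N #> (a \<otimes> b)"
    "(x \<otimes>\<^bsub>profinite_completion G\<^esub> y) M = M #> (a \<otimes> b)"
    using a b NM profinite_completion_mono[OF x NM a] profinite_completion_mono[OF y NM b]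
      normal.rcos_sum[OF fin_quotientsD(1)]
    by (simp_all add: profinite_completion_mult)
  then show "\<exists>g\<in>carrier G. (x \<otimes>\<^bsub>profinite_completion G\<^esub> y) N = N #> g \<and>
      (x \<otimes>\<^bsub>profinite_completion G\<^esub> y) M = M #> g"
    using a b by blast
qed (simp add: profinite_completion_def)

lemma profinite_map_closed:
  assumes "g \<in> carrier G"
  shows "profinite_map G g \<in> carrier (profinite_completion G)"
  using assms by (intro profinite_completionI) (auto simp: profinite_map_def)

lemma profinite_map_hom: "profinite_map G \<in> hom G (profinite_completion G)"
proof (rule homI)
  fix g h assume gh: "g \<in> carrier G" "h \<in> carrier G"
  have "N #> (g \<otimes> h) = (N #> g) <#> (N #> h)" if "N \<in> fin_quotients G" for N
    using normal.rcos_sum[OF fin_quotientsD(1)[OF that]] gh by simp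
  then show "profinite_map G (g \<otimes> h) =
      profinite_map G g \<otimes>\<^bsub>profinite_completion G\<^esub> profinite_map G h"
    by (simp add: profinite_map_def profinite_completion_def cong: restrict_cong)
qed (rule profinite_map_closed)

lemma topspace_profinite: "topspace (profinite_topology G) = carrier (profinite_completion G)"
  by (simp add: profinite_topology_def profinite_completion_def) blast

lemma continuous_profinite_proj:
  assumes "N \<in> fin_quotients G"
  shows "continuous_map (profinite_topology G) (discrete_topology (carrier (G Mod N))) (\<lambda>x. x N)"
  unfolding profinite_topology_def
  by (intro continuous_map_from_subtopology continuous_map_product_projection assms)

lemma openin_profinite_fiber:
  assumes "N \<in> fin_quotients G"
  shows "openin (profinite_topology G) {x \<in> carrier (profinite_completion G). P (x N)}"
proof -
  have "openin (profinite_topology G)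
      {x \<in> topspace (profinite_topology G). x N \<in> {c \<in> carrier (G Mod N). P c}}"
    by (rule openin_continuous_map_preimage[OF continuous_profinite_proj[OF assms]]) auto
  also have "{x \<in> topspace (profinite_topology G). x N \<in> {c \<in> carrier (G Mod N). P c}} =
      {x \<in> carrier (profinite_completion G). P (x N)}"
    using assms by (auto simp: topspace_profinite profinite_completion_def)
  finally show ?thesis .
qed

text \<open>A basic neighbourhood of \<open>x\<close> prescribes finitely many coordinates; since finite-index normal
  subgroups are closed under intersection, prescribing a single one is enough.\<close>

lemma mem_profinite_closure_iff:
  assumes S: "S \<subseteq> carrier G" and x: "x \<in> carrier (profinite_completion G)"
  shows "x \<in> profinite_closure G S \<longleftrightarrow> (\<forall>N\<in>fin_quotients G. \<exists>s\<in>S. x N = N #> s)"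
proof
  assume cl: "x \<in> profinite_closure G S"
  show "\<forall>N\<in>fin_quotients G. \<exists>s\<in>S. x N = N #> s"
  proof
    fix N assume N: "N \<in> fin_quotients G"
    let ?T = "{y \<in> carrier (profinite_completion G). y N = x N}"
    have "openin (profinite_topology G) ?T"
      by (rule openin_profinite_fiber[OF N])
    moreover have "x \<in> ?T" using x by simp
    ultimately have "\<exists>y. y \<in> profinite_map G ` S \<and> y \<in> ?T"
      using cl[unfolded profinite_closure_def in_closure_of] by presburger
    then show "\<exists>s\<in>S. x N = N #> s"
      using N by (auto simp: profinite_map_def)
  qed
next
  assume hit: "\<forall>N\<in>fin_quotients G. \<exists>s\<in>S. x N = N #> s"
  show "x \<in> profinite_closure G S"
    unfolding profinite_closure_def in_closure_of
  proof (intro conjI allI impI)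
    show "x \<in> topspace (profinite_topology G)" using x by (simp add: topspace_profinite)
    fix T assume T: "x \<in> T \<and> openin (profinite_topology G) T"
    let ?P = "product_topology (\<lambda>N. discrete_topology (carrier (G Mod N))) (fin_quotients G)"
    obtain T' where T': "openin ?P T'" "T = T' \<inter> carrier (profinite_completion G)"
      using T by (auto simp: profinite_topology_def openin_subtopology)
    have "x \<in> T'" using T T'(2) by simp
    then obtain U where fin: "finite {N \<in> fin_quotients G. U N \<noteq> carrier (G Mod N)}"
      and xU: "x \<in> Pi\<^sub>E (fin_quotients G) U" and UT: "Pi\<^sub>E (fin_quotients G) U \<subseteq> T'"
      using T'(1)[unfolded openin_product_topology_alt topspace_discrete_topology] by meson
    define \<N> where "\<N> = {N \<in> fin_quotients G. U N \<noteq> carrier (G Mod N)}"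
    define M where "M = carrier G \<inter> \<Inter>\<N>"
    have M: "M \<in> fin_quotients G"
      unfolding M_def using fin by (intro fin_quotients_Inter) (auto simp: \<N>_def)
    then obtain s where s: "s \<in> S" "x M = M #> s" using hit by blast
    have sG: "s \<in> carrier G" using s S by blast
    have "profinite_map G s \<in> Pi\<^sub>E (fin_quotients G) U"
    proof (rule PiE_I)
      fix N assume N: "N \<in> fin_quotients G"
      show "profinite_map G s N \<in> U N"
      proof (cases "N \<in> \<N>")
        case True
        then have "x N = N #> s"
          using profinite_completion_mono[OF x M N _ sG s(2)] by (auto simp: M_def)
        then show ?thesis
          using xU N by (auto simp: profinite_map_def PiE_iff)
      next
        case False
        then have "U N = carrier (G Mod N)" using N by (simp add: \<N>_def)
        then show ?thesis
          using N sG by (auto simp: profinite_map_def carrier_FactGroup)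
      qed
    qed (simp add: profinite_map_def)
    then show "\<exists>y. y \<in> profinite_map G ` S \<and> y \<in> T"
      using UT T'(2) s(1) profinite_map_closed[OF sG] by blast
  qed
qed

lemma profinite_closure_subset: "profinite_closure G S \<subseteq> carrier (profinite_completion G)"
  unfolding profinite_closure_def using closure_of_subset_topspace topspace_profinite by metis

end

section \<open>Homomorphisms from a free group\<close>

lemma gen_in_free_group: "x \<in> X \<Longrightarrow> [(x, b)] \<in> carrier (free_group X)"
  by (simp add: free_group_def)

lemma free_group_lift:
  assumes "group K" "f \<in> X \<rightarrow> carrier K"
  obtains h where "h \<in> hom (free_group X) K" "\<And>x. x \<in> X \<Longrightarrow> h [(x, True)] = f x"
  using free_group_universal[OF assms] by auto

lemma restrict_hom:
  assumes "group G" "f \<in> hom G K"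
  shows "restrict f (carrier G) \<in> Hom G K"
  using assms by (auto simp: Hom_def hom_def group.is_monoid monoid.m_closed)

lemma free_group_hom_eqI:
  assumes "group K" "f \<in> hom (free_group X) K" "g \<in> hom (free_group X) K"
    and eq: "\<And>x. x \<in> X \<Longrightarrow> f [(x, True)] = g [(x, True)]" and w: "w \<in> carrier (free_group X)"
  shows "f w = g w"
proof -
  let ?C = "carrier (free_group X)"
  have "(\<lambda>x. f [(x, True)]) \<in> X \<rightarrow> carrier K"
    using assms(2) gen_in_free_group by (fastforce simp: hom_def)
  from free_group_universal[OF assms(1) this]
  have uniq: "h = h'" if "h \<in> Hom (free_group X) K" "\<forall>x\<in>X. h [(x, True)] = f [(x, True)]"
    "h' \<in> Hom (free_group X) K" "\<forall>x\<in>X. h' [(x, True)] = f [(x, True)]" for h h'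
    using that unfolding Hom_def by blast
  have "restrict f ?C = restrict g ?C"
    by (rule uniq) (use eq restrict_hom[OF group_free_group assms(2)]
      restrict_hom[OF group_free_group assms(3)] in \<open>simp_all add: gen_in_free_group\<close>)
  then show ?thesis using w by (metis restrict_apply')
qed

lemma finite_Hom_free_group:
  assumes "finite X" "group K" "finite (carrier K)"
  shows "finite (Hom (free_group X) K)"
proof (rule finite_imageD)
  let ?r = "\<lambda>h. \<lambda>x\<in>X. h [(x, True)]"
  have "?r ` Hom (free_group X) K \<subseteq> X \<rightarrow>\<^sub>E carrier K"
    using gen_in_free_group by (fastforce simp: Hom_def hom_def)
  then show "finite (?r ` Hom (free_group X) K)"
    using assms by (meson finite_PiE finite_subset)
  show "inj_on ?r (Hom (free_group X) K)"
  proof (rule inj_onI)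
    fix f g assume fg: "f \<in> Hom (free_group X) K" "g \<in> Hom (free_group X) K" and eq: "?r f = ?r g"
    have "f [(x, True)] = g [(x, True)]" if "x \<in> X" for x
      using fun_cong[OF eq, of x] that by simp
    then have "f w = g w" if "w \<in> carrier (free_group X)" for w
      using fg free_group_hom_eqI[OF assms(2) _ _ _ that] by (auto simp: Hom_def)
    then show "f = g" using fg by (auto simp: Hom_def intro: extensionalityI)
  qed
qed

text \<open>Free groups are projective.\<close>

text \<open>Free groups are projective: representatives of the images of the generators may be chosen
  freely, and the resulting homomorphism lifts the given one because it does so on generators.\<close>

lemma free_group_projective:
  assumes G: "group G" and N: "N \<lhd> G" and f: "f \<in> hom (free_group X) (G Mod N)"
  obtains g where "g \<in> hom (free_group X) G" "\<And>w. w \<in> carrier (free_group X) \<Longrightarrow> f w = N #>\<^bsub>G\<^esub> g w"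
proof -
  have "\<forall>x\<in>X. \<exists>a\<in>carrier G. f [(x, True)] = N #>\<^bsub>G\<^esub> a"
    using f gen_in_free_group by (fastforce simp: hom_def carrier_FactGroup)
  then obtain a where a: "\<And>x. x \<in> X \<Longrightarrow> a x \<in> carrier G \<and> f [(x, True)] = N #>\<^bsub>G\<^esub> a x"
    by metis
  obtain g where g: "g \<in> hom (free_group X) G" "\<And>x. x \<in> X \<Longrightarrow> g [(x, True)] = a x"
    using free_group_lift[OF G, of a X] a by blast
  have "(\<lambda>w. N #>\<^bsub>G\<^esub> g w) \<in> hom (free_group X) (G Mod N)"
    using hom_compose[OF g(1) normal.r_coset_hom_Mod[OF N]] by (simp add: comp_def)
  then have "f w = N #>\<^bsub>G\<^esub> g w" if "w \<in> carrier (free_group X)" for w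
    using free_group_hom_eqI[OF normal.factorgroup_is_group[OF N] f _ _ that] g(2) a by simp
  then show ?thesis using that g(1) by blast
qed

section \<open>Permutation representations on cosets\<close>

text \<open>The domain and the range of a partial injection of a finite set have complements of the same size.\<close>

lemma extend_partial_permutation:
  assumes "finite A" "S \<subseteq> A" "inj_on p S" "p ` S \<subseteq> A"
  obtains q where "bij_betw q A A" "\<And>s. s \<in> S \<Longrightarrow> q s = p s"
proof -
  have "card (A - S) = card (A - p ` S)"
    using assms by (simp add: card_Diff_subset finite_subset card_image)
  then obtain r where r: "bij_betw r (A - S) (A - p ` S)"
    using assms finite_same_card_bij finite_Diff by metis
  have "bij_betw p S (p ` S)" using assms(3) by (simp add: bij_betw_def)
  then have "bij_betw (\<lambda>x. if x \<in> S then p x else r x) (S \<union> (A - S)) (p ` S \<union> (A - p ` S))"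
    using r by (rule bij_betw_disjoint_Un) auto
  then have "bij_betw (\<lambda>x. if x \<in> S then p x else r x) A A"
    using assms by (simp add: Un_absorb1)
  then show ?thesis by (rule that) simp
qed

lemma finite_Bij:
  assumes "finite A"
  shows "finite (carrier (BijGroup A))"
proof (rule finite_subset)
  show "carrier (BijGroup A) \<subseteq> A \<rightarrow>\<^sub>E A"
    by (auto simp: BijGroup_def Bij_def bij_betw_def extensional_def)
qed (use assms in \<open>simp add: finite_PiE\<close>)

lemma hom_BijGroup_mult:
  assumes "\<phi> \<in> hom G (BijGroup A)" "u \<in> carrier G" "v \<in> carrier G" "a \<in> A"
  shows "\<phi> (u \<otimes>\<^bsub>G\<^esub> v) a = \<phi> u (\<phi> v a)"
proof -
  have "\<phi> u \<in> Bij A" "\<phi> v \<in> Bij A"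
    using assms by (auto simp: hom_def BijGroup_def)
  then show ?thesis using assms by (simp add: hom_def BijGroup_def compose_def)
qed

lemma hom_BijGroup_closed:
  assumes "\<phi> \<in> hom G (BijGroup A)" "u \<in> carrier G" "a \<in> A"
  shows "\<phi> u a \<in> A"
proof -
  have "\<phi> u \<in> Bij A"
    using assms by (auto simp: hom_def BijGroup_def)
  then show ?thesis using assms(3) by (auto dest: Bij_imp_funcset)
qed

lemma hom_BijGroup_one:
  assumes "group G" "\<phi> \<in> hom G (BijGroup A)" "a \<in> A"
  shows "\<phi> \<one>\<^bsub>G\<^esub> a = a"
  using hom_one[OF assms(2,1) group_BijGroup] assms(3) by (simp add: BijGroup_def)

text \<open>The key to separating subgroups of free groups. The generators act on cosets of \<open>L\<close> by left translation. On a finite set \<open>A\<close> of cosets a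
  translation is only a partial injection, but it extends to a permutation of \<open>A\<close>; by freeness any
  choice of extensions defines an action. Along a word all of whose suffixes keep \<open>L\<close> inside \<open>A\<close>,
  the new action agrees with translation.\<close>

lemma coset_action:
  fixes X :: "'a set"
  defines "F \<equiv> free_group X"
  assumes L: "subgroup L F" and fin: "finite A" and A: "A \<subseteq> {u <#\<^bsub>F\<^esub> L | u. u \<in> carrier F}"
  obtains \<phi> where "\<phi> \<in> hom F (BijGroup A)"
    "\<And>w. w \<in> carrier F \<Longrightarrow> (\<And>u v. w = u @ v \<Longrightarrow> v <#\<^bsub>F\<^esub> L \<in> A) \<Longrightarrow> \<phi> w L = w <#\<^bsub>F\<^esub> L"
proof -
  interpret F: group F unfolding F_def by (rule group_free_group)
  have LF: "L \<subseteq> carrier F" using L by (rule subgroup.subset)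
  have AF: "C \<subseteq> carrier F" if "C \<in> A" for C
    using A that LF F.l_coset_subset_G by blast
  have gen: "[(x, b)] \<in> carrier F" if "x \<in> X" for x b
    using that unfolding F_def by (rule gen_in_free_group)
  \<comment> \<open>Translation by a letter is injective: the inverse letter translates back.\<close>
  have cancel: "[(x, \<not> b)] <#\<^bsub>F\<^esub> ([(x, b)] <#\<^bsub>F\<^esub> C) = C" if "x \<in> X" "C \<in> A" for x b C
  proof -
    have "[(x, \<not> b)] \<otimes>\<^bsub>F\<^esub> [(x, b)] = \<one>\<^bsub>F\<^esub>"
      by (simp add: F_def free_group_def letter_inv_def)
    then show ?thesis
      using that AF gen by (simp add: F.lcos_m_assoc F.lcos_mult_one)
  qed
  have "\<exists>q. bij_betw q A A \<and> (\<forall>C\<in>A. [(x, True)] <#\<^bsub>F\<^esub> C \<in> A \<longrightarrow> q C = [(x, True)] <#\<^bsub>F\<^esub> C)"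
    if x: "x \<in> X" for x
  proof -
    let ?S = "{C \<in> A. [(x, True)] <#\<^bsub>F\<^esub> C \<in> A}"
    have "inj_on (\<lambda>C. [(x, True)] <#\<^bsub>F\<^esub> C) ?S"
      by (rule inj_on_inverseI[of _ "\<lambda>C. [(x, False)] <#\<^bsub>F\<^esub> C"]) (use cancel[OF x, of _ True] in simp)
    then obtain q where "bij_betw q A A" "\<And>C. C \<in> ?S \<Longrightarrow> q C = [(x, True)] <#\<^bsub>F\<^esub> C"
      using extend_partial_permutation[OF fin, of ?S "\<lambda>C. [(x, True)] <#\<^bsub>F\<^esub> C"] by blast
    then show ?thesis by blast
  qed
  then obtain q where q: "\<And>x. x \<in> X \<Longrightarrow> bij_betw (q x) A A"
    "\<And>x C. x \<in> X \<Longrightarrow> C \<in> A \<Longrightarrow> [(x, True)] <#\<^bsub>F\<^esub> C \<in> A \<Longrightarrow> q x C = [(x, True)] <#\<^bsub>F\<^esub> C"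
    by metis
  have "(\<lambda>x. restrict (q x) A) \<in> X \<rightarrow> carrier (BijGroup A)"
    using q(1) by (simp add: BijGroup_def Bij_def bij_betw_restrict_eq)
  then obtain \<phi> where \<phi>: "\<phi> \<in> hom F (BijGroup A)"
    "\<And>x. x \<in> X \<Longrightarrow> \<phi> [(x, True)] = restrict (q x) A"
    using free_group_lift[OF group_BijGroup] unfolding F_def by metis
  have letter: "\<phi> [a] C = [a] <#\<^bsub>F\<^esub> C"
    if "fst a \<in> X" "C \<in> A" "[a] <#\<^bsub>F\<^esub> C \<in> A" for a C
  proof (cases a)
    case (Pair x b)
    have x: "x \<in> X" using that Pair by simp
    show ?thesis
    proof (cases b)
      case True
      then show ?thesis using Pair x that \<phi>(2) q(2) by simp
    next
      case False
      let ?D = "[a] <#\<^bsub>F\<^esub> C"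
      have D: "[(x, True)] <#\<^bsub>F\<^esub> ?D = C"
        using cancel[OF x that(2), of False] Pair False by simp
      then have "\<phi> [(x, True)] ?D = C"
        using \<phi>(2)[OF x] q(2)[OF x that(3)] that by simp
      moreover have "[a] \<otimes>\<^bsub>F\<^esub> [(x, True)] = \<one>\<^bsub>F\<^esub>"
        using Pair False by (simp add: F_def free_group_def letter_inv_def)
      ultimately show ?thesis
        using hom_BijGroup_mult[OF \<phi>(1), of "[a]" "[(x, True)]" ?D] gen[OF x] Pair that(3)
          hom_BijGroup_one[OF F.is_group \<phi>(1) that(3)] by simp
    qed
  qed
  have "\<phi> w L = w <#\<^bsub>F\<^esub> L"
    if "w \<in> carrier F" "\<And>u v. w = u @ v \<Longrightarrow> v <#\<^bsub>F\<^esub> L \<in> A" for w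
    using that
  proof (induction w)
    case Nil
    have one: "[] = \<one>\<^bsub>F\<^esub>" by (simp add: F_def free_group_def)
    have "L \<in> A" using Nil(2)[of "[]" "[]"] one F.lcos_mult_one[OF LF] by simp
    then show ?case
      using one hom_BijGroup_one[OF F.is_group \<phi>(1)] F.lcos_mult_one[OF LF] by simp
  next
    case (Cons a w)
    have w: "w \<in> carrier F" "[a] \<in> carrier F" "fst a \<in> X" and aw: "a # w = [a] \<otimes>\<^bsub>F\<^esub> w"
      using Cons.prems(1) by (auto simp: F_def free_group_def push_reduced dest: reduced_tl)
    have IH: "\<phi> w L = w <#\<^bsub>F\<^esub> L"
      using Cons.IH[OF w(1)] Cons.prems(2) by (metis append_Cons)
    have "w <#\<^bsub>F\<^esub> L \<in> A" "(a # w) <#\<^bsub>F\<^esub> L \<in> A" "L \<in> A"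
      using Cons.prems(2)[of "[a]" w] Cons.prems(2)[of "[]" "a # w"] Cons.prems(2)[of "a # w" "[]"]
        F.lcos_mult_one[OF LF] by (auto simp: F_def free_group_def)
    moreover have "(a # w) <#\<^bsub>F\<^esub> L = [a] <#\<^bsub>F\<^esub> (w <#\<^bsub>F\<^esub> L)"
      unfolding aw using w LF by (simp add: F.lcos_m_assoc)
    ultimately show ?case
      using letter[OF w(3)] IH hom_BijGroup_mult[OF \<phi>(1) w(2) w(1)] aw by metis
  qed
  with \<phi>(1) show ?thesis using that by blast
qed

section \<open>A cofinal chain of fully invariant subgroups\<close>

text \<open>The elements that act trivially in every permutation representation of degree at most \<open>k\<close>.
  Unlike a general chain of finite-index normal subgroups, these are mapped into themselves by all
  endomorphisms, so that every endomorphism induces one on each quotient. Letting the degree \<open>j\<close> run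
  through all values up to \<open>k\<close> makes the chain visibly decreasing. Using the fixed sets \<open>{..<j}\<close>
  keeps the number of representations of a free group of finite rank finite.\<close>

definition perm_level :: "'a set \<Rightarrow> nat \<Rightarrow> ('a \<times> bool) list set" where
  "perm_level X k = {w \<in> carrier (free_group X).
     \<forall>j\<le>k. \<forall>\<phi>\<in>hom (free_group X) (BijGroup {..<j}). \<phi> w = \<one>\<^bsub>BijGroup {..<j}\<^esub>}"

lemma perm_level_antimono: "j \<le> k \<Longrightarrow> perm_level X k \<subseteq> perm_level X j"
  by (auto simp: perm_level_def)

lemma perm_level_fin_quotient:
  assumes "finite X"
  shows "perm_level X k \<in> fin_quotients (free_group X)"
proof -
  interpret F: group "free_group X" by (rule group_free_group)
  let ?N = "(\<Union>j\<le>k. kernel (free_group X) (BijGroup {..<j}) ` Hom (free_group X) (BijGroup {..<j}))"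
  have "perm_level X k = carrier (free_group X) \<inter> \<Inter>?N"
  proof (intro equalityI subsetI)
    fix w assume "w \<in> perm_level X k"
    then show "w \<in> carrier (free_group X) \<inter> \<Inter>?N"
      by (auto simp: perm_level_def kernel_def Hom_def)
  next
    fix w assume w: "w \<in> carrier (free_group X) \<inter> \<Inter>?N"
    have "\<phi> w = \<one>\<^bsub>BijGroup {..<j}\<^esub>"
      if "j \<le> k" "\<phi> \<in> hom (free_group X) (BijGroup {..<j})" for j \<phi>
    proof -
      have "w \<in> kernel (free_group X) (BijGroup {..<j}) (restrict \<phi> (carrier (free_group X)))"
        using w that restrict_hom[OF F.is_group that(2)] by blast
      then have "w \<in> carrier (free_group X)" "restrict \<phi> (carrier (free_group X)) w = \<one>\<^bsub>BijGroup {..<j}\<^esub>"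
        unfolding kernel_def by blast+
      then show ?thesis by (metis restrict_apply')
    qed
    then show "w \<in> perm_level X k" using w by (auto simp: perm_level_def)
  qed
  moreover have "finite ?N"
    using assms by (intro finite_UN_I finite_imageI finite_Hom_free_group group_BijGroup finite_Bij) auto
  moreover have "?N \<subseteq> fin_quotients (free_group X)"
    by (auto simp: Hom_def intro!: F.kernel_fin_quotient group_BijGroup finite_Bij)
  ultimately show ?thesis using F.fin_quotients_Inter by simp
qed

lemma perm_level_fully_invariant:
  assumes "g \<in> hom (free_group X) (free_group X)" "w \<in> perm_level X k"
  shows "g w \<in> perm_level X k"
proof -
  have "\<phi> (g w) = \<one>\<^bsub>BijGroup {..<j}\<^esub>"
    if "j \<le> k" "\<phi> \<in> hom (free_group X) (BijGroup {..<j})" for j \<phi>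
  proof -
    have "(\<phi> \<circ> g) w = \<one>\<^bsub>BijGroup {..<j}\<^esub>"
      using assms(2) that(1) hom_compose[OF assms(1) that(2)] unfolding perm_level_def by blast
    then show ?thesis by simp
  qed
  moreover have "g w \<in> carrier (free_group X)"
    using assms by (auto simp: perm_level_def hom_def)
  ultimately show ?thesis by (simp add: perm_level_def)
qed

text \<open>An action on an arbitrary finite set becomes one on \<open>{..<card A}\<close> after conjugation with an
  enumeration of \<open>A\<close>.\<close>

lemma perm_level_acts_trivially:
  assumes fin: "finite A" "card A \<le> k" and \<phi>: "\<phi> \<in> hom (free_group X) (BijGroup A)"
    and w: "w \<in> perm_level X k" and a: "a \<in> A"
  shows "\<phi> w a = a"
proof -
  interpret F: group "free_group X" by (rule group_free_group)
  let ?B = "{..<card A}"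
  obtain \<beta> where \<beta>: "bij_betw \<beta> ?B A"
    using ex_bij_betw_nat_finite[OF fin(1)] by (auto simp: atLeast0LessThan)
  define \<gamma> where "\<gamma> = inv_into ?B \<beta>"
  have \<gamma>: "bij_betw \<gamma> A ?B" unfolding \<gamma>_def using \<beta> by (rule bij_betw_inv_into)
  have \<beta>A: "\<beta> i \<in> A" if "i < card A" for i using \<beta> that by (auto simp: bij_betw_def)
  have \<gamma>B: "\<gamma> c < card A" if "c \<in> A" for c using \<gamma> that by (auto simp: bij_betw_def)
  have \<beta>\<gamma>: "\<beta> (\<gamma> c) = c" if "c \<in> A" for c
    unfolding \<gamma>_def using \<beta> that by (rule bij_betw_inv_into_right)
  define \<psi> where "\<psi> = (\<lambda>w. \<lambda>i\<in>?B. \<gamma> (\<phi> w (\<beta> i)))"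
  have closed: "\<psi> u \<in> Bij ?B" if "u \<in> carrier (free_group X)" for u
  proof -
    have "bij_betw (\<phi> u) A A"
      using \<phi> that by (auto simp: hom_def BijGroup_def Bij_def)
    then have "bij_betw (\<gamma> \<circ> (\<phi> u \<circ> \<beta>)) ?B ?B"
      using \<beta> \<gamma> by (intro bij_betw_trans)
    then show ?thesis
      by (simp add: \<psi>_def Bij_def bij_betw_restrict_eq comp_def)
  qed
  have "\<psi> \<in> hom (free_group X) (BijGroup ?B)"
  proof (rule homI)
    fix u v assume uv: "u \<in> carrier (free_group X)" "v \<in> carrier (free_group X)"
    have "\<psi> (u \<otimes>\<^bsub>free_group X\<^esub> v) i = compose ?B (\<psi> u) (\<psi> v) i" for i
      using uv \<beta>A \<gamma>B \<beta>\<gamma> hom_BijGroup_closed[OF \<phi>]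
      by (auto simp: \<psi>_def compose_def hom_BijGroup_mult[OF \<phi>])
    then show "\<psi> (u \<otimes>\<^bsub>free_group X\<^esub> v) = \<psi> u \<otimes>\<^bsub>BijGroup ?B\<^esub> \<psi> v"
      using closed uv by (simp add: BijGroup_def ext)
  qed (simp add: BijGroup_def closed)
  then have "\<psi> w = \<one>\<^bsub>BijGroup ?B\<^esub>"
    using w fin(2) by (auto simp: perm_level_def)
  then have "\<psi> w (\<gamma> a) = \<gamma> a" using \<gamma>B[OF a] by (simp add: BijGroup_def)
  then have "\<gamma> (\<phi> w a) = \<gamma> a"
    using a \<gamma>B \<beta>\<gamma> by (simp add: \<psi>_def)
  moreover have "\<phi> w a \<in> A"
    using w a hom_BijGroup_closed[OF \<phi>] by (auto simp: perm_level_def)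
  ultimately show ?thesis using a \<beta>\<gamma> by metis
qed

lemma finite_lcosets:
  assumes "group G" "subgroup H G" "finite_index G H"
  shows "finite {u <#\<^bsub>G\<^esub> H | u. u \<in> carrier G}"
proof (rule finite_surj)
  interpret G: group G by fact
  interpret H: subgroup H G by fact
  show "finite (rcosets\<^bsub>G\<^esub> H)" using assms(3) by (simp add: finite_index_def)
  have "u <#\<^bsub>G\<^esub> H = m_inv G ` (H #>\<^bsub>G\<^esub> inv\<^bsub>G\<^esub> u)" if u: "u \<in> carrier G" for u
  proof (intro equalityI subsetI)
    fix x assume "x \<in> u <#\<^bsub>G\<^esub> H"
    then obtain h where h: "h \<in> H" "x = u \<otimes>\<^bsub>G\<^esub> h" by (auto simp: l_coset_def)
    then have "x = inv\<^bsub>G\<^esub> (inv\<^bsub>G\<^esub> h \<otimes>\<^bsub>G\<^esub> inv\<^bsub>G\<^esub> u)" using u by (simp add: G.inv_mult_group)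
    then show "x \<in> m_inv G ` (H #>\<^bsub>G\<^esub> inv\<^bsub>G\<^esub> u)" using h by (auto simp: r_coset_def)
  next
    fix x assume "x \<in> m_inv G ` (H #>\<^bsub>G\<^esub> inv\<^bsub>G\<^esub> u)"
    then obtain h where "h \<in> H" "x = inv\<^bsub>G\<^esub> (h \<otimes>\<^bsub>G\<^esub> inv\<^bsub>G\<^esub> u)" by (auto simp: r_coset_def)
    then show "x \<in> u <#\<^bsub>G\<^esub> H" using u by (auto simp: l_coset_def G.inv_mult_group)
  qed
  then have "u <#\<^bsub>G\<^esub> H \<in> (\<lambda>C. m_inv G ` C) ` (rcosets\<^bsub>G\<^esub> H)" if "u \<in> carrier G" for u
    using that G.rcosetsI[OF H.subset, of "inv\<^bsub>G\<^esub> u"] by (metis G.inv_closed imageI)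
  then show "{u <#\<^bsub>G\<^esub> H | u. u \<in> carrier G} \<subseteq> (\<lambda>C. m_inv G ` C) ` (rcosets\<^bsub>G\<^esub> H)"
    by blast
qed

lemma mem_of_lcoset_eq:
  assumes "group G" "subgroup L G" "x \<in> carrier G" "x <#\<^bsub>G\<^esub> L = L"
  shows "x \<in> L"
proof -
  interpret G: group G by fact
  have "x \<otimes>\<^bsub>G\<^esub> \<one>\<^bsub>G\<^esub> \<in> x <#\<^bsub>G\<^esub> L"
    using subgroup.one_closed[OF assms(2)] by (auto simp: l_coset_def)
  then show ?thesis using assms by simp
qed

lemma suffix_in_free_group:
  "u @ v \<in> carrier (free_group X) \<Longrightarrow> v \<in> carrier (free_group X)"
  by (auto simp: free_group_def reduced_word_def successively_append_iff image_Un)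

text \<open>Cofinality of the chain: \<open>H\<close> is the stabilizer of a point in the action on all of its left
  cosets, a permutation representation of finite degree.\<close>

lemma perm_level_subset_finite_index:
  assumes H: "subgroup H (free_group X)" "finite_index (free_group X) H"
  obtains k where "perm_level X k \<subseteq> H"
proof -
  interpret F: group "free_group X" by (rule group_free_group)
  let ?A = "{u <#\<^bsub>free_group X\<^esub> H | u. u \<in> carrier (free_group X)}"
  have fin: "finite ?A" using finite_lcosets[OF F.is_group H] .
  obtain \<phi> where \<phi>: "\<phi> \<in> hom (free_group X) (BijGroup ?A)"
    and act: "\<And>w. w \<in> carrier (free_group X) \<Longrightarrow>
      (\<And>u v. w = u @ v \<Longrightarrow> v <#\<^bsub>free_group X\<^esub> H \<in> ?A) \<Longrightarrow> \<phi> w H = w <#\<^bsub>free_group X\<^esub> H"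
    using coset_action[OF H(1) fin subset_refl] by blast
  have HA: "H \<in> ?A"
    using F.lcos_mult_one[OF subgroup.subset[OF H(1)]] by (metis (mono_tags, lifting) F.one_closed mem_Collect_eq)
  have "w \<in> H" if w: "w \<in> perm_level X (card ?A)" for w
  proof -
    have wF: "w \<in> carrier (free_group X)" using w by (simp add: perm_level_def)
    have suf: "v \<in> carrier (free_group X)" if "w = u @ v" for u v
      using wF that suffix_in_free_group by blast
    have "w <#\<^bsub>free_group X\<^esub> H = \<phi> w H" using act[OF wF] suf by blast
    also have "\<dots> = H" using perm_level_acts_trivially[OF fin order_refl \<phi> w HA] .
    finally show ?thesis by (rule mem_of_lcoset_eq[OF F.is_group H(1) wF])
  qed
  then show ?thesis using that by blast
qed

text \<open>M. Hall's theorem: finitely generated subgroups of free groups are closed in the profinite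
  topology. Consider the finitely many cosets \<open>v <# L\<close>, where \<open>v\<close> is a suffix of \<open>x\<close> or of one of the
  generators of \<open>L\<close>. In the finite action on these given by \<open>coset_action\<close>, the generators of \<open>L\<close> fix
  the point \<open>L\<close>, while \<open>x\<close> moves it to \<open>x <# L\<close>. If \<open>x\<close> agrees with an element of \<open>L\<close> up to something
  that acts trivially, then \<open>x <# L = L\<close>.\<close>

lemma perm_level_separates_finitely_generated:
  assumes L: "subgroup L (free_group X)" "finitely_generated (free_group X) L"
    and x: "x \<in> carrier (free_group X)"
    and near: "\<And>k. \<exists>l\<in>L. x \<in> perm_level X k #>\<^bsub>free_group X\<^esub> l"
  shows "x \<in> L"
proof -
  interpret F: group "free_group X" by (rule group_free_group)
  obtain S where S: "finite S" "S \<subseteq> carrier (free_group X)" "L = generate (free_group X) S"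
    using L(2) by (auto simp: finitely_generated_def)
  define T where "T = (\<Union>w\<in>insert x S. {v. \<exists>u. w = u @ v})"
  let ?A = "(\<lambda>v. v <#\<^bsub>free_group X\<^esub> L) ` T"
  have "finite {v. \<exists>u. w = u @ v}" for w :: "('a \<times> bool) list"
  proof (rule finite_subset)
    show "{v. \<exists>u. w = u @ v} \<subseteq> (\<lambda>n. drop n w) ` {..length w}"
    proof
      fix v assume "v \<in> {v. \<exists>u. w = u @ v}"
      then obtain u where "w = u @ v" by blast
      then show "v \<in> (\<lambda>n. drop n w) ` {..length w}"
        by (intro image_eqI[where x = "length u"]) auto
    qed
  qed simp
  then have fin: "finite ?A" using S(1) by (auto simp: T_def)
  have T: "v \<in> carrier (free_group X)" if v: "v \<in> T" for v
  proof -
    obtain w where w: "w \<in> insert x S" "\<exists>u. w = u @ v"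
      using v unfolding T_def by blast
    then have "w \<in> carrier (free_group X)" using x S(2) by (metis insertE subsetD)
    with w(2) show ?thesis using suffix_in_free_group by blast
  qed
  have A: "?A \<subseteq> {u <#\<^bsub>free_group X\<^esub> L | u. u \<in> carrier (free_group X)}"
    using T by (intro image_subsetI CollectI exI conjI) auto
  obtain \<phi> where \<phi>: "\<phi> \<in> hom (free_group X) (BijGroup ?A)"
    and act: "\<And>w. w \<in> carrier (free_group X) \<Longrightarrow>
      (\<And>u v. w = u @ v \<Longrightarrow> v <#\<^bsub>free_group X\<^esub> L \<in> ?A) \<Longrightarrow> \<phi> w L = w <#\<^bsub>free_group X\<^esub> L"
    using coset_action[OF L(1) fin A] by metis
  have act': "\<phi> w L = w <#\<^bsub>free_group X\<^esub> L" if "w \<in> insert x S" for w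
    using that x S(2) by (intro act) (auto simp: T_def)
  have "[] \<in> T" by (auto simp: T_def)
  then have LA: "L \<in> ?A"
    using F.lcos_mult_one[OF subgroup.subset[OF L(1)]] by (force simp: free_group_def)
  have fix_L: "\<phi> l L = L" if "l \<in> L" for l
    using that unfolding S(3)
  proof (induction rule: generate.induct)
    case one
    then show ?case using hom_BijGroup_one[OF F.is_group \<phi> LA] S(3) by simp
  next
    case (incl s)
    then have "s \<in> L" "s \<in> carrier (free_group X)" using S by (auto intro: generate.incl)
    then show ?case using act'[of s] incl F.coset_join3[OF _ L(1)] S(3) by simp
  next
    case (inv s)
    then have s: "s \<in> L" "s \<in> carrier (free_group X)" using S by (auto intro: generate.incl)
    then have "\<phi> s L = L" using act'[of s] inv F.coset_join3[OF _ L(1)] by simp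
    then have "\<phi> (inv\<^bsub>free_group X\<^esub> s) L = \<phi> (inv\<^bsub>free_group X\<^esub> s \<otimes>\<^bsub>free_group X\<^esub> s) L"
      using hom_BijGroup_mult[OF \<phi> F.inv_closed[OF s(2)] s(2) LA] by simp
    then show ?case using s hom_BijGroup_one[OF F.is_group \<phi> LA] S(3) by simp
  next
    case (eng s t)
    then have "s \<in> carrier (free_group X)" "t \<in> carrier (free_group X)"
      using S(2) F.generate_in_carrier by blast+
    then show ?case using hom_BijGroup_mult[OF \<phi> _ _ LA] eng S(3) by simp
  qed
  obtain l where l: "l \<in> L" "x \<in> perm_level X (card ?A) #>\<^bsub>free_group X\<^esub> l" using near by blast
  then obtain w where w: "w \<in> perm_level X (card ?A)" "x = w \<otimes>\<^bsub>free_group X\<^esub> l"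
    by (auto simp: r_coset_def)
  have "w \<in> carrier (free_group X)" "l \<in> carrier (free_group X)"
    using w l subgroup.subset[OF L(1)] by (auto simp: perm_level_def)
  then have "\<phi> x L = \<phi> w L"
    using w(2) hom_BijGroup_mult[OF \<phi> _ _ LA] fix_L[OF l(1)] by simp
  also have "\<dots> = L" by (rule perm_level_acts_trivially[OF fin order_refl \<phi> w(1) LA])
  finally have "x <#\<^bsub>free_group X\<^esub> L = L" using act'[of x] by simp
  then show ?thesis by (rule mem_of_lcoset_eq[OF F.is_group L(1) x])
qed

section \<open>Measure equivalence at the level of finite quotients\<close>

text \<open>The two fractions that measure equivalence compares have the same denominator, which is
  positive because there is the trivial homomorphism.\<close>

lemma card_extensions_eq:
  fixes K :: "('k, 'm) monoid_scheme"
  assumes G: "group G" "subgroup H G" "subgroup L G" and me: "measure_equivalent_via G H L \<alpha>"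
    and K: "group K" "finite (carrier K)" and fin: "finite (Hom G K)"
    and h: "h \<in> Hom (G\<lparr>carrier := L\<rparr>) K"
  shows "card {f \<in> Hom G K. restrict f L = h} = card {f \<in> Hom G K. restrict f H = compose H h \<alpha>}"
proof -
  have "(\<lambda>x\<in>carrier G. \<one>\<^bsub>K\<^esub>) \<in> Hom G K"
    using G(1) K(1) by (auto simp: Hom_def hom_def group.is_monoid monoid.m_closed)
  then have "card (Hom G K) \<noteq> 0" using fin by auto
  then show ?thesis
    using measure_equivalent_via_finite[OF G me K h] by (simp add: Pr_hom_def)
qed

lemma card_by_image:
  assumes G: "group G" and Q: "group Q" "finite (carrier Q)" and fin: "finite (Hom G Q)"
  shows "card {f \<in> Hom G Q. restrict f T = c \<and> f ` carrier G \<subseteq> S} =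
    (\<Sum>S' | subgroup S' Q \<and> S' \<subseteq> S. card {f \<in> Hom G Q. restrict f T = c \<and> f ` carrier G = S'})"
proof -
  let ?I = "{S'. subgroup S' Q \<and> S' \<subseteq> S}"
  let ?E = "\<lambda>S'. {f \<in> Hom G Q. restrict f T = c \<and> f ` carrier G = S'}"
  have "subgroup (f ` carrier G) Q" if "f \<in> Hom G Q" for f
  proof -
    interpret f: group_hom G Q f
      using that G Q by (auto simp: Hom_def intro!: group_hom.intro group_hom_axioms.intro)
    show ?thesis by (rule f.img_is_subgroup)
  qed
  then have "{f \<in> Hom G Q. restrict f T = c \<and> f ` carrier G \<subseteq> S} = (\<Union>S'\<in>?I. ?E S')"
    by blast
  moreover have "finite ?I"
    using Q(2) by (rule_tac finite_subset[of _ "Pow (carrier Q)"]) (auto dest: subgroup.subset)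
  moreover have "\<forall>S'\<in>?I. finite (?E S')" using fin by simp
  moreover have "\<forall>S'\<in>?I. \<forall>S''\<in>?I. S' \<noteq> S'' \<longrightarrow> ?E S' \<inter> ?E S'' = {}" by blast
  ultimately show ?thesis by (simp add: card_UN_disjoint)
qed

text \<open>Measure equivalence, applied to the subgroup \<open>S\<close> as target, says that there are equally many
  extensions with image inside \<open>S\<close>. Sorting these by their exact image, the counts of extensions with image exactly
  \<open>S\<close> agree too, by induction on the order of \<open>S\<close>.\<close>

lemma card_extensions_onto_eq:
  fixes Q :: "('k, 'm) monoid_scheme"
  assumes G: "group G" "subgroup H G" "subgroup L G" and me: "measure_equivalent_via G H L \<alpha>"
    and Q: "group Q" "finite (carrier Q)"
    and fin: "\<And>S. subgroup S Q \<Longrightarrow> finite (Hom G (Q\<lparr>carrier := S\<rparr>))"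
    and h: "h \<in> Hom (G\<lparr>carrier := L\<rparr>) Q" and S: "subgroup S Q"
  shows "card {f \<in> Hom G Q. restrict f L = h \<and> f ` carrier G = S} =
         card {f \<in> Hom G Q. restrict f H = compose H h \<alpha> \<and> f ` carrier G = S}"
  using S
proof (induction "card S" arbitrary: S rule: less_induct)
  case less
  interpret Q: group Q by fact
  have sub: "L \<subseteq> carrier G" "H \<subseteq> carrier G" using G by (auto dest: subgroup.subset)
  have \<alpha>: "\<alpha> ` H = L" using me by (auto simp: measure_equivalent_via_def iso_def bij_betw_def)
  have finS: "finite S" using less.prems Q(2) by (meson finite_subset subgroup.subset)
  have "Q\<lparr>carrier := carrier Q\<rparr> = Q" by simp
  then have finQ: "finite (Hom G Q)" using fin[OF Q.subgroup_self] by simp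
  \<comment> \<open>Homomorphisms to \<open>Q\<close> with image inside \<open>S\<close> are homomorphisms to \<open>S\<close>.\<close>
  have into: "{f \<in> Hom G Q. restrict f T = c \<and> f ` carrier G \<subseteq> S} =
      {f \<in> Hom G (Q\<lparr>carrier := S\<rparr>). restrict f T = c}" for T c
    using subgroup.subset[OF less.prems] by (auto simp: Hom_def hom_def)
  have *: "card {f \<in> Hom G Q. restrict f L = h \<and> f ` carrier G \<subseteq> S} =
      card {f \<in> Hom G Q. restrict f H = compose H h \<alpha> \<and> f ` carrier G \<subseteq> S}"
  proof (cases "h ` L \<subseteq> S")
    case True
    then have "h \<in> Hom (G\<lparr>carrier := L\<rparr>) (Q\<lparr>carrier := S\<rparr>)"
      using h by (auto simp: Hom_def hom_def)
    from card_extensions_eq[OF G me Q.subgroup_imp_group[OF less.prems] _ fin[OF less.prems] this]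
    show ?thesis unfolding into using finS by simp
  next
    case False
    have "h ` L \<subseteq> S" if "restrict f L = h" "f ` carrier G \<subseteq> S" for f
      using that sub(1) image_restrict_eq[of f L] by blast
    moreover have "h ` L \<subseteq> S" if eq: "restrict f H = compose H h \<alpha>" "f ` carrier G \<subseteq> S" for f
    proof -
      have "h (\<alpha> x) = f x" if "x \<in> H" for x
        using fun_cong[OF eq(1), of x] that by (simp add: compose_def)
      then show ?thesis using \<alpha> eq(2) sub(2) by force
    qed
    ultimately have "{f \<in> Hom G Q. restrict f L = h \<and> f ` carrier G \<subseteq> S} = {}"
      "{f \<in> Hom G Q. restrict f H = compose H h \<alpha> \<and> f ` carrier G \<subseteq> S} = {}"
      using False by blast+
    then show ?thesis by (simp only:)
  qed
  let ?I = "{S'. subgroup S' Q \<and> S' \<subseteq> S}"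
  let ?EL = "\<lambda>S'. card {f \<in> Hom G Q. restrict f L = h \<and> f ` carrier G = S'}"
  let ?EH = "\<lambda>S'. card {f \<in> Hom G Q. restrict f H = compose H h \<alpha> \<and> f ` carrier G = S'}"
  have finI: "finite ?I" using finS by (rule_tac finite_subset[of _ "Pow S"]) auto
  have "sum ?EL ?I = sum ?EH ?I"
    using * by (simp add: card_by_image[OF G(1) Q finQ])
  moreover have "sum ?EL (?I - {S}) = sum ?EH (?I - {S})"
    using less.hyps finS by (intro sum.cong) (auto intro: psubset_card_mono)
  moreover have "S \<in> ?I" using less.prems by simp
  ultimately show ?case
    using finI by (simp add: sum.remove[of ?I S])
qed

text \<open>Applied to \<open>h = \<pi>\<close> restricted to \<open>L\<close> and to the whole of \<open>Q\<close>: there is an extension of \<open>h\<close>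
  onto \<open>Q\<close>, namely \<open>\<pi>\<close>, hence also one of \<open>h \<circ> \<alpha>\<close>.\<close>

corollary transfer_epimorphism:
  fixes Q :: "('k, 'm) monoid_scheme"
  assumes G: "group G" "subgroup H G" "subgroup L G" and me: "measure_equivalent_via G H L \<alpha>"
    and Q: "group Q" "finite (carrier Q)"
    and fin: "\<And>S. subgroup S Q \<Longrightarrow> finite (Hom G (Q\<lparr>carrier := S\<rparr>))"
    and \<pi>: "\<pi> \<in> epi G Q"
  obtains f where "f \<in> epi G Q" "\<And>x. x \<in> H \<Longrightarrow> f x = \<pi> (\<alpha> x)"
proof -
  interpret Q: group Q by fact
  have L: "L \<subseteq> carrier G" and H: "H \<subseteq> carrier G" using G by (auto dest: subgroup.subset)
  have \<alpha>: "\<alpha> ` H = L" using me by (auto simp: measure_equivalent_via_def iso_def bij_betw_def)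
  define h where "h = restrict \<pi> L"
  have h: "h \<in> Hom (G\<lparr>carrier := L\<rparr>) Q"
    using \<pi> L subgroup.m_closed[OF G(3)] by (auto simp: h_def Hom_def hom_def epi_def subset_iff)
  have "Q\<lparr>carrier := carrier Q\<rparr> = Q" by simp
  then have finQ: "finite (Hom G Q)" using fin[OF Q.subgroup_self] by simp
  let ?EL = "{f \<in> Hom G Q. restrict f L = h \<and> f ` carrier G = carrier Q}"
  let ?EH = "{f \<in> Hom G Q. restrict f H = compose H h \<alpha> \<and> f ` carrier G = carrier Q}"
  have \<pi>': "restrict \<pi> (carrier G) \<in> ?EL"
    using \<pi> L restrict_hom[OF G(1), of \<pi> Q] by (auto simp: h_def epi_def Int_absorb1)
  have "finite ?EL" using finQ by simp
  with \<pi>' have "card ?EL > 0" using card_gt_0_iff by blast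
  then have "?EH \<noteq> {}"
    using card_extensions_onto_eq[OF G me Q fin h Q.subgroup_self] by (metis card.empty less_irrefl)
  then obtain f where f: "f \<in> Hom G Q" "restrict f H = compose H h \<alpha>" "f ` carrier G = carrier Q"
    by blast
  have "f x = \<pi> (\<alpha> x)" if "x \<in> H" for x
    using fun_cong[OF f(2), of x] that \<alpha> by (auto simp: compose_def h_def)
  moreover have "f \<in> epi G Q" using f by (simp add: Hom_def epi_def)
  ultimately show ?thesis using that by blast
qed

section \<open>Continuous automorphisms as limits of endomorphisms\<close>

text \<open>The map \<open>q\<close> factors through \<open>p\<close> by a surjective self-map of the finite set \<open>A\<close>, which must be
  injective.\<close>

lemma finite_surj_factor_inj:
  assumes "finite A" "p ` S = A" "q ` S = A"
    and "\<And>x y. x \<in> S \<Longrightarrow> y \<in> S \<Longrightarrow> p x = p y \<Longrightarrow> q x = q y"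
    and "x \<in> S" "y \<in> S" "q x = q y"
  shows "p x = p y"
proof -
  define \<psi> where "\<psi> a = q (SOME x. x \<in> S \<and> p x = a)" for a
  have \<psi>: "\<psi> (p x) = q x" if "x \<in> S" for x
  proof -
    have "(SOME y. y \<in> S \<and> p y = p x) \<in> S \<and> p (SOME y. y \<in> S \<and> p y = p x) = p x"
      by (rule someI[of _ x]) (simp add: that)
    then show ?thesis unfolding \<psi>_def using assms(4) that by blast
  qed
  have "\<psi> ` A = A"
    using \<psi> assms(2,3) by (metis (no_types, lifting) image_cong image_image)
  then have "inj_on \<psi> A" using assms(1) by (simp add: eq_card_imp_inj_on)
  then show ?thesis
    using \<psi> assms(2,5,6,7) by (metis imageI inj_onD)
qed

text \<open>A diagonal argument in the manner of Koenig's lemma: choose decreasing infinite index sets on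
  which \<open>c 0\<close>, \<open>c 1\<close>, ... become constant one after the other, and \<open>m k\<close> in the \<open>k\<close>-th of them.\<close>

lemma coherent_choice:
  fixes c :: "nat \<Rightarrow> nat \<Rightarrow> 'b"
  assumes "\<And>j. finite (range (c j))"
  obtains m where "\<And>k. k \<le> m k" "\<And>j k. j \<le> k \<Longrightarrow> c j (m k) = c j (m j)"
proof -
  have step: "\<exists>I' \<subseteq> I. infinite I' \<and> (\<forall>i\<in>I'. \<forall>i'\<in>I'. c j i = c j i')" if I: "infinite I" for I j
  proof -
    have "finite (c j ` I)" using assms[of j] by (rule finite_subset[rotated]) auto
    then obtain i where "i \<in> I" "infinite {i' \<in> I. c j i' = c j i}"
      using pigeonhole_infinite[OF I] by blast
    then show ?thesis by (intro exI[of _ "{i' \<in> I. c j i' = c j i}"]) auto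
  qed
  have "\<exists>I. \<forall>j. (infinite (I j) \<and> (\<forall>i\<in>I j. \<forall>i'\<in>I j. c j i = c j i')) \<and> I (Suc j) \<subseteq> I j"
  proof (rule dependent_nat_choice)
    show "\<exists>I. infinite I \<and> (\<forall>i\<in>I. \<forall>i'\<in>I. c 0 i = c 0 i')"
      using step[OF infinite_UNIV_nat, of 0] by blast
    fix I j assume "infinite I \<and> (\<forall>i\<in>I. \<forall>i'\<in>I. c j i = c j i')"
    then show "\<exists>I'. (infinite I' \<and> (\<forall>i\<in>I'. \<forall>i'\<in>I'. c (Suc j) i = c (Suc j) i')) \<and> I' \<subseteq> I"
      using step[of I "Suc j"] by blast
  qed
  then obtain I where "\<forall>j. (infinite (I j) \<and> (\<forall>i\<in>I j. \<forall>i'\<in>I j. c j i = c j i')) \<and> I (Suc j) \<subseteq> I j" ..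
  then have I: "\<And>j. infinite (I j)" "\<And>j i i'. i \<in> I j \<Longrightarrow> i' \<in> I j \<Longrightarrow> c j i = c j i'"
    "\<And>j. I (Suc j) \<subseteq> I j" by blast+
  have mono: "I k \<subseteq> I j" if "j \<le> k" for j k
    using lift_Suc_antimono_le[of I, OF I(3) that] .
  have "\<exists>i\<in>I k. k \<le> i" for k
    using I(1)[of k] by (auto simp: infinite_nat_iff_unbounded_le)
  then obtain m where "\<And>k. m k \<in> I k" "\<And>k. k \<le> m k" by metis
  then show ?thesis using that I(2) mono by (meson subsetD)
qed

text \<open>A sequence of endomorphisms that converges level by level and is onto modulo each level. The
  \<open>e k\<close> need not be automorphisms, but their limit is a continuous automorphism of the profinite
  completion.\<close>

locale coherent_endomorphisms =
  fixes X :: "'a set" and e :: "nat \<Rightarrow> ('a \<times> bool) list \<Rightarrow> ('a \<times> bool) list"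
  assumes finite_X: "finite X"
    and e_hom: "e k \<in> hom (free_group X) (free_group X)"
    and e_coherent: "j \<le> k \<Longrightarrow> w \<in> carrier (free_group X) \<Longrightarrow>
      perm_level X j #>\<^bsub>free_group X\<^esub> e k w = perm_level X j #>\<^bsub>free_group X\<^esub> e j w"
    and e_onto: "w \<in> carrier (free_group X) \<Longrightarrow> \<exists>v\<in>carrier (free_group X).
      perm_level X k #>\<^bsub>free_group X\<^esub> e k v = perm_level X k #>\<^bsub>free_group X\<^esub> w"
begin

abbreviation F where "F \<equiv> free_group X"
abbreviation P where "P \<equiv> perm_level X"
abbreviation Fhat where "Fhat \<equiv> profinite_completion F"

sublocale F: group F by (rule group_free_group)

lemma P: "P k \<in> fin_quotients F" "P k \<lhd> F" "subgroup (P k) F"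
  using perm_level_fin_quotient[OF finite_X] fin_quotientsD by blast+

lemma e_closed: "w \<in> carrier F \<Longrightarrow> e k w \<in> carrier F"
  using e_hom by (auto simp: hom_def)

lemma cofinal:
  assumes "N \<in> fin_quotients F"
  obtains k where "P k \<subseteq> N"
  using perm_level_subset_finite_index[of N X] assms
  by (auto simp: fin_quotients_def normal_imp_subgroup)

lemma e_cong:
  assumes "v \<in> carrier F" "w \<in> carrier F" "P k #>\<^bsub>F\<^esub> v = P k #>\<^bsub>F\<^esub> w"
  shows "P k #>\<^bsub>F\<^esub> e k v = P k #>\<^bsub>F\<^esub> e k w"
proof -
  interpret e: group_hom F F "e k" by (intro group_hom.intro group_hom_axioms.intro F.is_group e_hom)
  have "e k (v \<otimes>\<^bsub>F\<^esub> inv\<^bsub>F\<^esub> w) \<in> P k"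
    using assms F.rcos_eq_iff[OF P(3)] by (intro perm_level_fully_invariant[OF e_hom]) simp
  then have "e k v \<otimes>\<^bsub>F\<^esub> inv\<^bsub>F\<^esub> (e k w) \<in> P k" using assms by simp
  then show ?thesis using F.rcos_eq_iff[OF P(3) e_closed e_closed] assms by simp
qed

lemma e_inj:
  assumes "v \<in> carrier F" "w \<in> carrier F" "P k #>\<^bsub>F\<^esub> e k v = P k #>\<^bsub>F\<^esub> e k w"
  shows "P k #>\<^bsub>F\<^esub> v = P k #>\<^bsub>F\<^esub> w"
proof (rule finite_surj_factor_inj[where S = "carrier F" and q = "\<lambda>v. P k #>\<^bsub>F\<^esub> e k v"])
  show "finite (rcosets\<^bsub>F\<^esub> (P k))" using fin_quotientsD(3)[OF P(1)] .
  show "(\<lambda>v. P k #>\<^bsub>F\<^esub> v) ` carrier F = rcosets\<^bsub>F\<^esub> (P k)" by (auto simp: RCOSETS_def)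
  show "(\<lambda>v. P k #>\<^bsub>F\<^esub> e k v) ` carrier F = rcosets\<^bsub>F\<^esub> (P k)"
  proof (intro equalityI subsetI)
    fix C assume "C \<in> (\<lambda>v. P k #>\<^bsub>F\<^esub> e k v) ` carrier F"
    then show "C \<in> rcosets\<^bsub>F\<^esub> (P k)" using e_closed by (auto simp: RCOSETS_def)
  next
    fix C assume "C \<in> rcosets\<^bsub>F\<^esub> (P k)"
    then obtain w where "w \<in> carrier F" "C = P k #>\<^bsub>F\<^esub> w" by (auto simp: RCOSETS_def)
    moreover from this obtain v where "v \<in> carrier F" "P k #>\<^bsub>F\<^esub> e k v = P k #>\<^bsub>F\<^esub> w"
      using e_onto[of w k] by blast
    ultimately show "C \<in> (\<lambda>v. P k #>\<^bsub>F\<^esub> e k v) ` carrier F" by (intro image_eqI[where x = v]) simp_all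
  qed
qed (fact e_cong assms)+

text \<open>On the coordinate at \<open>N\<close> the limit is computed with any \<open>e k\<close> for which \<open>P k \<subseteq> N\<close> and any
  representative \<open>w\<close> of the coordinate at \<open>P k\<close>; \<open>limit_map_eq\<close> shows that the choice of this
  pair does not matter.\<close>

definition limit_rep where
  "limit_rep x N = (SOME (k, w). P k \<subseteq> N \<and> w \<in> carrier F \<and> x (P k) = P k #>\<^bsub>F\<^esub> w)"

definition limit_map where
  "limit_map x = (\<lambda>N\<in>fin_quotients F. case limit_rep x N of (k, w) \<Rightarrow> N #>\<^bsub>F\<^esub> e k w)"

lemma limit_map_eq:
  assumes x: "x \<in> carrier Fhat" and N: "N \<in> fin_quotients F"
    and k: "P k \<subseteq> N" and w: "w \<in> carrier F" "x (P k) = P k #>\<^bsub>F\<^esub> w"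
  shows "limit_map x N = N #>\<^bsub>F\<^esub> e k w"
proof -
  have NF: "subgroup N F" using fin_quotientsD(2)[OF N] .
  \<comment> \<open>Two choices are compared through a third one at a deeper level.\<close>
  have *: "N #>\<^bsub>F\<^esub> e i u = N #>\<^bsub>F\<^esub> e j v"
    if "i \<le> j" "P i \<subseteq> N" "u \<in> carrier F" "x (P i) = P i #>\<^bsub>F\<^esub> u"
      "v \<in> carrier F" "x (P j) = P j #>\<^bsub>F\<^esub> v" for i j u v
  proof (rule F.rcos_eq_mono[OF that(2) P(3) NF])
    have "x (P i) = P i #>\<^bsub>F\<^esub> v"
      using F.profinite_completion_mono[OF x P(1) P(1) _ that(5,6)] that(1)
      by (simp add: perm_level_antimono)
    then have "P i #>\<^bsub>F\<^esub> e i u = P i #>\<^bsub>F\<^esub> e i v"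
      using that by (intro e_cong) simp_all
    then show "P i #>\<^bsub>F\<^esub> e i u = P i #>\<^bsub>F\<^esub> e j v"
      using e_coherent[OF that(1,5)] by simp
  qed (use that e_closed in auto)
  obtain k' w' where r: "limit_rep x N = (k', w')" by (cases "limit_rep x N")
  have "case limit_rep x N of (k, w) \<Rightarrow> P k \<subseteq> N \<and> w \<in> carrier F \<and> x (P k) = P k #>\<^bsub>F\<^esub> w"
    unfolding limit_rep_def by (rule someI[of _ "(k, w)"]) (use k w in simp)
  then have k': "P k' \<subseteq> N" "w' \<in> carrier F" "x (P k') = P k' #>\<^bsub>F\<^esub> w'" using r by auto
  obtain v where v: "v \<in> carrier F" "x (P (max k k')) = P (max k k') #>\<^bsub>F\<^esub> v"
    using F.profinite_completion_coset[OF x P(1)] .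
  have "N #>\<^bsub>F\<^esub> e k w = N #>\<^bsub>F\<^esub> e k' w'"
    using *[OF _ k w v] *[OF _ k' v] by simp
  then show ?thesis using N r by (simp add: limit_map_def)
qed

lemma limit_map_witness:
  assumes "x \<in> carrier Fhat" "N \<in> fin_quotients F"
  obtains k w where "P k \<subseteq> N" "w \<in> carrier F" "x (P k) = P k #>\<^bsub>F\<^esub> w" "limit_map x N = N #>\<^bsub>F\<^esub> e k w"
proof -
  obtain k where k: "P k \<subseteq> N" using cofinal[OF assms(2)] .
  obtain w where w: "w \<in> carrier F" "x (P k) = P k #>\<^bsub>F\<^esub> w"
    using F.profinite_completion_coset[OF assms(1) P(1)] .
  show ?thesis using that[OF k w limit_map_eq[OF assms k w]] .
qed

lemma limit_map_closed:
  assumes x: "x \<in> carrier Fhat"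
  shows "limit_map x \<in> carrier Fhat"
proof (rule F.profinite_completionI)
  show "limit_map x \<in> extensional (fin_quotients F)" by (simp add: limit_map_def)
  fix N M assume NM: "N \<in> fin_quotients F" "M \<in> fin_quotients F" "N \<subseteq> M"
  obtain k w where k: "P k \<subseteq> N" "w \<in> carrier F" "x (P k) = P k #>\<^bsub>F\<^esub> w"
      "limit_map x N = N #>\<^bsub>F\<^esub> e k w"
    using limit_map_witness[OF x NM(1)] .
  have "limit_map x M = M #>\<^bsub>F\<^esub> e k w"
    using k NM(3) by (intro limit_map_eq[OF x NM(2)]) auto
  then show "\<exists>g\<in>carrier F. limit_map x N = N #>\<^bsub>F\<^esub> g \<and> limit_map x M = M #>\<^bsub>F\<^esub> g"
    using k e_closed by blast
qed

lemma limit_map_hom: "limit_map \<in> hom Fhat Fhat"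
proof (rule homI)
  fix x y assume x: "x \<in> carrier Fhat" and y: "y \<in> carrier Fhat"
  have xy: "x \<otimes>\<^bsub>Fhat\<^esub> y \<in> carrier Fhat" using F.profinite_completion_m_closed[OF x y] .
  show "limit_map (x \<otimes>\<^bsub>Fhat\<^esub> y) = limit_map x \<otimes>\<^bsub>Fhat\<^esub> limit_map y"
  proof (rule F.profinite_completion_eqI)
    fix N assume N: "N \<in> fin_quotients F"
    obtain k where k: "P k \<subseteq> N" using cofinal[OF N] .
    obtain a where a: "a \<in> carrier F" "x (P k) = P k #>\<^bsub>F\<^esub> a"
      using F.profinite_completion_coset[OF x P(1)] .
    obtain b where b: "b \<in> carrier F" "y (P k) = P k #>\<^bsub>F\<^esub> b"
      using F.profinite_completion_coset[OF y P(1)] .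
    have "(x \<otimes>\<^bsub>Fhat\<^esub> y) (P k) = P k #>\<^bsub>F\<^esub> (a \<otimes>\<^bsub>F\<^esub> b)"
      using a b by (simp add: F.profinite_completion_mult[OF P(1)] normal.rcos_sum[OF P(2)])
    then have "limit_map (x \<otimes>\<^bsub>Fhat\<^esub> y) N = N #>\<^bsub>F\<^esub> e k (a \<otimes>\<^bsub>F\<^esub> b)"
      using a b by (intro limit_map_eq[OF xy N k]) auto
    also have "\<dots> = (N #>\<^bsub>F\<^esub> e k a) <#>\<^bsub>F\<^esub> (N #>\<^bsub>F\<^esub> e k b)"
      using a b e_closed hom_mult[OF e_hom] normal.rcos_sum[OF fin_quotientsD(1)[OF N]] by simp
    also have "\<dots> = (limit_map x \<otimes>\<^bsub>Fhat\<^esub> limit_map y) N"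
      using limit_map_eq[OF x N k a] limit_map_eq[OF y N k b]
      by (simp add: F.profinite_completion_mult[OF N])
    finally show "limit_map (x \<otimes>\<^bsub>Fhat\<^esub> y) N = (limit_map x \<otimes>\<^bsub>Fhat\<^esub> limit_map y) N" .
  qed (use x y xy limit_map_closed F.profinite_completion_m_closed in auto)
qed (rule limit_map_closed)

lemma eq_of_levels:
  assumes x: "x \<in> carrier Fhat" and y: "y \<in> carrier Fhat" and eq: "\<And>k. x (P k) = y (P k)"
  shows "x = y"
proof (rule F.profinite_completion_eqI[OF x y])
  fix N assume N: "N \<in> fin_quotients F"
  obtain k where k: "P k \<subseteq> N" using cofinal[OF N] .
  obtain w where "w \<in> carrier F" "x (P k) = P k #>\<^bsub>F\<^esub> w"
    using F.profinite_completion_coset[OF x P(1)] .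
  then show "x N = y N"
    using F.profinite_completion_mono[OF x P(1) N k] F.profinite_completion_mono[OF y P(1) N k] eq
    by metis
qed

lemma limit_map_inj: "inj_on limit_map (carrier Fhat)"
proof (rule inj_onI)
  fix x y assume x: "x \<in> carrier Fhat" and y: "y \<in> carrier Fhat" and eq: "limit_map x = limit_map y"
  show "x = y"
  proof (rule eq_of_levels[OF x y])
    fix k
    obtain a where a: "a \<in> carrier F" "x (P k) = P k #>\<^bsub>F\<^esub> a"
      using F.profinite_completion_coset[OF x P(1)] .
    obtain b where b: "b \<in> carrier F" "y (P k) = P k #>\<^bsub>F\<^esub> b"
      using F.profinite_completion_coset[OF y P(1)] .
    have "P k #>\<^bsub>F\<^esub> e k a = P k #>\<^bsub>F\<^esub> e k b"
      using limit_map_eq[OF x P(1) subset_refl a] limit_map_eq[OF y P(1) subset_refl b] eq by simp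
    then show "x (P k) = y (P k)" using e_inj[OF a(1) b(1)] a(2) b(2) by metis
  qed
qed

text \<open>Modulo each level there is a preimage \<open>a k\<close>; it is unique modulo that level by injectivity,
  and for this reason the \<open>a k\<close> fit together to an element of the completion.\<close>

lemma limit_map_onto:
  assumes y: "y \<in> carrier Fhat"
  obtains x where "x \<in> carrier Fhat" "limit_map x = y"
proof -
  have "\<exists>a b. a \<in> carrier F \<and> b \<in> carrier F \<and> y (P k) = P k #>\<^bsub>F\<^esub> b \<and>
      P k #>\<^bsub>F\<^esub> e k a = P k #>\<^bsub>F\<^esub> b" for k
  proof -
    obtain b where "b \<in> carrier F" "y (P k) = P k #>\<^bsub>F\<^esub> b"
      using F.profinite_completion_coset[OF y P(1)] .
    then show ?thesis using e_onto[of b k] by blast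
  qed
  then obtain a b where a: "\<And>k. a k \<in> carrier F" and b: "\<And>k. b k \<in> carrier F"
    and yb: "\<And>k. y (P k) = P k #>\<^bsub>F\<^esub> b k" and ab: "\<And>k. P k #>\<^bsub>F\<^esub> e k (a k) = P k #>\<^bsub>F\<^esub> b k"
    by metis
  have a_coherent: "P j #>\<^bsub>F\<^esub> a k = P j #>\<^bsub>F\<^esub> a j" if "j \<le> k" for j k
  proof (rule e_inj[OF a a])
    have sub: "P k \<subseteq> P j" using that by (rule perm_level_antimono)
    have "P j #>\<^bsub>F\<^esub> e j (a k) = P j #>\<^bsub>F\<^esub> e k (a k)" using e_coherent[OF that a] by simp
    also have "\<dots> = P j #>\<^bsub>F\<^esub> b k"
      using F.rcos_eq_mono[OF sub P(3) P(3) e_closed[OF a] b ab] .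
    also have "\<dots> = P j #>\<^bsub>F\<^esub> b j"
      using F.profinite_completion_mono[OF y P(1) P(1) sub b yb] yb by simp
    finally show "P j #>\<^bsub>F\<^esub> e j (a k) = P j #>\<^bsub>F\<^esub> e j (a j)" using ab by simp
  qed
  define \<kappa> where "\<kappa> N = (SOME k. P k \<subseteq> N)" for N
  define x where "x = (\<lambda>N\<in>fin_quotients F. N #>\<^bsub>F\<^esub> a (\<kappa> N))"
  have \<kappa>: "P (\<kappa> N) \<subseteq> N" if "P k \<subseteq> N" for N k
    unfolding \<kappa>_def using that by (rule someI)
  have x_eq: "x N = N #>\<^bsub>F\<^esub> a k" if N: "N \<in> fin_quotients F" and k: "P k \<subseteq> N" for N k
  proof -
    have sub: "subgroup N F" using fin_quotientsD(2)[OF N] .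
    let ?j = "max k (\<kappa> N)"
    have "N #>\<^bsub>F\<^esub> a ?j = N #>\<^bsub>F\<^esub> a k"
      by (rule F.rcos_eq_mono[OF k P(3) sub a a a_coherent]) simp
    moreover have "N #>\<^bsub>F\<^esub> a ?j = N #>\<^bsub>F\<^esub> a (\<kappa> N)"
      by (rule F.rcos_eq_mono[OF \<kappa>[OF k] P(3) sub a a a_coherent]) simp
    ultimately show ?thesis using N by (simp add: x_def)
  qed
  have x: "x \<in> carrier Fhat"
  proof (rule F.profinite_completionI)
    fix N M assume NM: "N \<in> fin_quotients F" "M \<in> fin_quotients F" "N \<subseteq> M"
    obtain k where "P k \<subseteq> N" using cofinal[OF NM(1)] .
    then show "\<exists>g\<in>carrier F. x N = N #>\<^bsub>F\<^esub> g \<and> x M = M #>\<^bsub>F\<^esub> g"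
      using NM x_eq a by (meson order_trans)
  qed (simp add: x_def)
  have "limit_map x = y"
  proof (rule eq_of_levels[OF limit_map_closed[OF x] y])
    fix k
    show "limit_map x (P k) = y (P k)"
      using limit_map_eq[OF x P(1) subset_refl a x_eq[OF P(1) subset_refl]] ab yb by simp
  qed
  with x show ?thesis using that by blast
qed

text \<open>The coordinate of the image at \<open>N\<close> is determined by the coordinate of the argument at one
  level \<open>P k \<subseteq> N\<close>.\<close>

lemma limit_map_continuous:
  "continuous_map (profinite_topology F) (profinite_topology F) limit_map"
proof -
  have "continuous_map (profinite_topology F) (discrete_topology (carrier (F Mod N))) (\<lambda>x. limit_map x N)"
    if N: "N \<in> fin_quotients F" for N
    unfolding continuous_map_def
  proof (intro conjI allI impI)
    show "(\<lambda>x. limit_map x N) \<in> topspace (profinite_topology F) \<rightarrow>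
        topspace (discrete_topology (carrier (F Mod N)))"
      using N limit_map_closed
      by (auto simp: F.topspace_profinite profinite_completion_def PiE_iff)
    fix U assume "openin (discrete_topology (carrier (F Mod N))) U"
    obtain k where k: "P k \<subseteq> N" using cofinal[OF N] .
    have "limit_map x N \<in> U \<longleftrightarrow> (\<exists>w\<in>carrier F. x (P k) = P k #>\<^bsub>F\<^esub> w \<and> N #>\<^bsub>F\<^esub> e k w \<in> U)"
      if x: "x \<in> carrier Fhat" for x
    proof -
      obtain v where v: "v \<in> carrier F" "x (P k) = P k #>\<^bsub>F\<^esub> v"
        using F.profinite_completion_coset[OF x P(1)] .
      show ?thesis
      proof
        assume "limit_map x N \<in> U"
        then show "\<exists>w\<in>carrier F. x (P k) = P k #>\<^bsub>F\<^esub> w \<and> N #>\<^bsub>F\<^esub> e k w \<in> U"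
          using v limit_map_eq[OF x N k v] by auto
      next
        assume "\<exists>w\<in>carrier F. x (P k) = P k #>\<^bsub>F\<^esub> w \<and> N #>\<^bsub>F\<^esub> e k w \<in> U"
        then obtain w where w: "w \<in> carrier F" "x (P k) = P k #>\<^bsub>F\<^esub> w" "N #>\<^bsub>F\<^esub> e k w \<in> U"
          by blast
        then show "limit_map x N \<in> U" using limit_map_eq[OF x N k w(1,2)] by simp
      qed
    qed
    then have "{x \<in> topspace (profinite_topology F). limit_map x N \<in> U} =
        {x \<in> carrier Fhat. \<exists>w\<in>carrier F. x (P k) = P k #>\<^bsub>F\<^esub> w \<and> N #>\<^bsub>F\<^esub> e k w \<in> U}"
      by (auto simp: F.topspace_profinite)
    then show "openin (profinite_topology F) {x \<in> topspace (profinite_topology F). limit_map x N \<in> U}"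
      using F.openin_profinite_fiber[OF P(1),
          of "\<lambda>c. \<exists>w\<in>carrier F. c = P k #>\<^bsub>F\<^esub> w \<and> N #>\<^bsub>F\<^esub> e k w \<in> U"] by simp
  qed
  then have "continuous_map (profinite_topology F)
      (product_topology (\<lambda>N. discrete_topology (carrier (F Mod N))) (fin_quotients F)) limit_map"
    unfolding continuous_map_componentwise by (auto simp: limit_map_def)
  moreover have "limit_map \<in> topspace (profinite_topology F) \<rightarrow> carrier Fhat"
    using limit_map_closed by (simp add: F.topspace_profinite)
  ultimately show ?thesis
    by (simp add: profinite_topology_def[of F] continuous_map_in_subtopology)
qed

lemma limit_map_continuous_aut: "limit_map \<in> continuous_aut F"
proof -
  have "limit_map ` carrier Fhat = carrier Fhat"
    using limit_map_closed limit_map_onto by (auto simp: image_iff) metis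
  then have "limit_map \<in> iso Fhat Fhat"
    using limit_map_hom limit_map_inj by (simp add: iso_def bij_betw_def)
  then show ?thesis using limit_map_continuous by (simp add: continuous_aut_def)
qed

end

section \<open>Subgroups measure equivalent to a profinitely characteristic subgroup\<close>

lemma carrier_FactGroup_rcosets: "carrier (G Mod N) = rcosets\<^bsub>G\<^esub> N"
  by (simp add: FactGroup_def)

text \<open>The projection to the quotient by \<open>N\<close>, restricted to \<open>L\<close> and pulled back along \<open>\<alpha>\<close>, extends
  to another epimorphism onto that quotient; projectivity lifts it to an endomorphism.\<close>

lemma measure_equivalent_endomorphism:
  assumes X: "finite X" and HL: "subgroup H (free_group X)" "subgroup L (free_group X)"
    and me: "measure_equivalent_via (free_group X) H L \<alpha>" and N: "N \<in> fin_quotients (free_group X)"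
  obtains g where "g \<in> hom (free_group X) (free_group X)"
    "\<And>x. x \<in> H \<Longrightarrow> N #>\<^bsub>free_group X\<^esub> g x = N #>\<^bsub>free_group X\<^esub> \<alpha> x"
    "\<And>w. w \<in> carrier (free_group X) \<Longrightarrow>
      \<exists>v\<in>carrier (free_group X). N #>\<^bsub>free_group X\<^esub> g v = N #>\<^bsub>free_group X\<^esub> w"
proof -
  interpret F: group "free_group X" by (rule group_free_group)
  interpret N: normal N "free_group X" using fin_quotientsD(1)[OF N] .
  let ?Q = "free_group X Mod N"
  have Q: "group ?Q" by (rule N.factorgroup_is_group)
  have finQ: "finite (carrier ?Q)" using fin_quotientsD(3)[OF N] by (simp add: carrier_FactGroup_rcosets)
  have fin: "finite (Hom (free_group X) (?Q\<lparr>carrier := S\<rparr>))" if "subgroup S ?Q" for S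
  proof (rule finite_Hom_free_group[OF X])
    show "group (?Q\<lparr>carrier := S\<rparr>)" using group.subgroup_imp_group[OF Q that] .
    show "finite (carrier (?Q\<lparr>carrier := S\<rparr>))"
      using finite_subset[OF subgroup.subset[OF that] finQ] by simp
  qed
  have "(\<lambda>w. N #>\<^bsub>free_group X\<^esub> w) \<in> epi (free_group X) ?Q"
    using N.r_coset_hom_Mod by (simp add: epi_def carrier_FactGroup)
  then obtain f where f: "f \<in> epi (free_group X) ?Q"
    "\<And>x. x \<in> H \<Longrightarrow> f x = N #>\<^bsub>free_group X\<^esub> \<alpha> x"
    using transfer_epimorphism[OF F.is_group HL me Q finQ fin] by blast
  have "f \<in> hom (free_group X) ?Q" using f(1) by (simp add: epi_def)
  then obtain g where g: "g \<in> hom (free_group X) (free_group X)"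
    "\<And>w. w \<in> carrier (free_group X) \<Longrightarrow> f w = N #>\<^bsub>free_group X\<^esub> g w"
    using free_group_projective[OF F.is_group N.normal_axioms] by blast
  show ?thesis
  proof (rule that[OF g(1)])
    fix x assume "x \<in> H"
    then show "N #>\<^bsub>free_group X\<^esub> g x = N #>\<^bsub>free_group X\<^esub> \<alpha> x"
      using f(2) g(2) subgroup.mem_carrier[OF HL(1)] by metis
  next
    fix w assume "w \<in> carrier (free_group X)"
    then have "N #>\<^bsub>free_group X\<^esub> w \<in> f ` carrier (free_group X)"
      using f(1) by (auto simp: epi_def carrier_FactGroup)
    then show "\<exists>v\<in>carrier (free_group X). N #>\<^bsub>free_group X\<^esub> g v = N #>\<^bsub>free_group X\<^esub> w"
      using g(2) by auto
  qed
qed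

text \<open>The endomorphisms for the various levels need not be compatible, but modulo a given level
  only finitely many homomorphisms occur, so a compatible sequence can be selected.\<close>

lemma measure_equivalent_coherent:
  assumes X: "finite X" and HL: "subgroup H (free_group X)" "subgroup L (free_group X)"
    and me: "measure_equivalent_via (free_group X) H L \<alpha>"
  obtains e where "coherent_endomorphisms X e"
    "\<And>k x. x \<in> H \<Longrightarrow>
      perm_level X k #>\<^bsub>free_group X\<^esub> e k x = perm_level X k #>\<^bsub>free_group X\<^esub> \<alpha> x"
proof -
  let ?F = "free_group X"
  let ?P = "perm_level X"
  interpret F: group ?F by (rule group_free_group)
  note fq = perm_level_fin_quotient[OF X]
  have P: "?P k \<lhd> ?F" "subgroup (?P k) ?F" for k
    using fin_quotientsD[OF fq] by auto
  have \<alpha>: "\<alpha> x \<in> carrier ?F" if "x \<in> H" for x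
    using me that subgroup.subset[OF HL(2)]
    by (auto simp: measure_equivalent_via_def iso_def hom_def Pi_iff)
  have H: "x \<in> carrier ?F" if "x \<in> H" for x using that subgroup.mem_carrier[OF HL(1)] by blast
  have "\<exists>g. g \<in> hom ?F ?F \<and> (\<forall>x\<in>H. ?P k #>\<^bsub>?F\<^esub> g x = ?P k #>\<^bsub>?F\<^esub> \<alpha> x) \<and>
      (\<forall>w\<in>carrier ?F. \<exists>v\<in>carrier ?F. ?P k #>\<^bsub>?F\<^esub> g v = ?P k #>\<^bsub>?F\<^esub> w)" for k
    by (rule measure_equivalent_endomorphism[OF X HL me fq[of k]]) blast
  then obtain g where g_hom: "\<And>k. g k \<in> hom ?F ?F"
    and g_\<alpha>: "\<And>k x. x \<in> H \<Longrightarrow> ?P k #>\<^bsub>?F\<^esub> g k x = ?P k #>\<^bsub>?F\<^esub> \<alpha> x"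
    and g_onto: "\<And>k w. w \<in> carrier ?F \<Longrightarrow> \<exists>v\<in>carrier ?F. ?P k #>\<^bsub>?F\<^esub> g k v = ?P k #>\<^bsub>?F\<^esub> w"
    by metis
  have g_closed: "g k w \<in> carrier ?F" if "w \<in> carrier ?F" for k w
    using g_hom that by (auto simp: hom_def)
  define c where "c j i = (\<lambda>w\<in>carrier ?F. ?P j #>\<^bsub>?F\<^esub> g i w)" for j i
  have "finite (range (c j))" for j
  proof (rule finite_subset)
    show "range (c j) \<subseteq> Hom ?F (?F Mod ?P j)"
      using restrict_hom[OF F.is_group hom_compose[OF g_hom normal.r_coset_hom_Mod[OF P(1)]]]
      by (auto simp: c_def comp_def)
    show "finite (Hom ?F (?F Mod ?P j))"
      using X normal.factorgroup_is_group[OF P(1)] fin_quotientsD(3)[OF fq]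
      by (intro finite_Hom_free_group) (simp_all add: carrier_FactGroup_rcosets)
  qed
  then obtain m where m: "\<And>k. k \<le> m k" "\<And>j k. j \<le> k \<Longrightarrow> c j (m k) = c j (m j)"
    using coherent_choice[of c] by metis
  \<comment> \<open>The endomorphism chosen for level \<open>k\<close> is good even at the deeper level \<open>m k\<close>.\<close>
  have sub: "?P (m k) \<subseteq> ?P k" for k using m(1) by (rule perm_level_antimono)
  show ?thesis
  proof (rule that[of "\<lambda>k. g (m k)"])
    show "coherent_endomorphisms X (\<lambda>k. g (m k))"
    proof
      fix j k :: nat and w assume "j \<le> k" and w: "w \<in> carrier ?F"
      then show "?P j #>\<^bsub>?F\<^esub> g (m k) w = ?P j #>\<^bsub>?F\<^esub> g (m j) w"
        using fun_cong[OF m(2), of j k w] by (simp add: c_def)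
    next
      fix w k assume w: "w \<in> carrier ?F"
      obtain v where v: "v \<in> carrier ?F" "?P (m k) #>\<^bsub>?F\<^esub> g (m k) v = ?P (m k) #>\<^bsub>?F\<^esub> w"
        using g_onto[OF w] by blast
      have "?P k #>\<^bsub>?F\<^esub> g (m k) v = ?P k #>\<^bsub>?F\<^esub> w"
        by (rule F.rcos_eq_mono[OF sub P(2) P(2) g_closed[OF v(1)] w v(2)])
      with v(1) show "\<exists>v\<in>carrier ?F. ?P k #>\<^bsub>?F\<^esub> g (m k) v = ?P k #>\<^bsub>?F\<^esub> w" by blast
    qed (use X g_hom in auto)
  next
    fix k x assume x: "x \<in> H"
    show "?P k #>\<^bsub>?F\<^esub> g (m k) x = ?P k #>\<^bsub>?F\<^esub> \<alpha> x"
      by (rule F.rcos_eq_mono[OF sub P(2) P(2) g_closed[OF H[OF x]] \<alpha>[OF x] g_\<alpha>[OF x]])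
  qed
qed

text \<open>The limit automorphism extends \<open>\<alpha>\<close> and preserves the closure of \<open>H\<close>. Therefore \<open>\<alpha>\<close> maps \<open>H\<close>
  into its closure, which meets the free group in \<open>H\<close> itself. Conversely, modulo each level every
  element of \<open>H\<close> agrees with some \<open>\<alpha> s\<close>, so it lies in the closure of \<open>L\<close>, and \<open>L\<close> is closed.\<close>

theorem profinitely_characteristic_rigid:
  assumes X: "finite X" and H: "profinitely_characteristic (free_group X) H"
    and L: "subgroup L (free_group X)" "finitely_generated (free_group X) L"
    and me: "measure_equivalent (free_group X) H L"
  shows "L = H"
proof -
  have HF: "subgroup H (free_group X)" "finite_index (free_group X) H"
    using H by (auto simp: profinitely_characteristic_def)
  obtain \<alpha> where me: "measure_equivalent_via (free_group X) H L \<alpha>"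
    using me by (auto simp: measure_equivalent_def)
  have \<alpha>H: "\<alpha> ` H = L" using me by (auto simp: measure_equivalent_via_def iso_def bij_betw_def)
  obtain e where "coherent_endomorphisms X e"
    and e_\<alpha>: "\<And>k x. x \<in> H \<Longrightarrow>
      perm_level X k #>\<^bsub>free_group X\<^esub> e k x = perm_level X k #>\<^bsub>free_group X\<^esub> \<alpha> x"
    using measure_equivalent_coherent[OF X HF(1) L(1) me] by blast
  then interpret coherent_endomorphisms X e by simp
  let ?C = "profinite_closure F H"
  have \<Theta>: "limit_map ` ?C = ?C"
    using H limit_map_continuous_aut by (auto simp: profinitely_characteristic_def)
  have HsF: "H \<subseteq> carrier F" using HF(1) by (rule subgroup.subset)
  note C_iff = F.mem_profinite_closure_iff[OF HsF]
  have \<iota>C: "profinite_map F x \<in> ?C" if "x \<in> H" for x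
    using that HsF C_iff[OF F.profinite_map_closed] by (auto simp: profinite_map_def)
  have \<alpha>_closed: "\<alpha> x \<in> carrier F" if "x \<in> H" for x
    using that \<alpha>H subgroup.subset[OF L(1)] by auto
  have "\<alpha> x \<in> H" if x: "x \<in> H" for x
  proof -
    obtain k where k: "P k \<subseteq> H" using perm_level_subset_finite_index[OF HF] .
    have xF: "x \<in> carrier F" using x HsF by blast
    let ?y = "limit_map (profinite_map F x)"
    have y: "?y \<in> carrier Fhat"
      by (rule limit_map_closed[OF F.profinite_map_closed[OF xF]])
    have "?y \<in> ?C" using \<iota>C[OF x] \<Theta> by blast
    then obtain s where s: "s \<in> H" "?y (P k) = P k #>\<^bsub>F\<^esub> s"
      using C_iff[OF y] P(1) by blast
    have "?y (P k) = P k #>\<^bsub>F\<^esub> e k x"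
      using P(1) by (intro limit_map_eq[OF F.profinite_map_closed[OF xF] P(1) subset_refl xF])
        (simp add: profinite_map_def)
    then have "P k #>\<^bsub>F\<^esub> \<alpha> x = P k #>\<^bsub>F\<^esub> s" using s(2) e_\<alpha>[OF x] by simp
    then have "\<alpha> x \<otimes>\<^bsub>F\<^esub> inv\<^bsub>F\<^esub> s \<in> H"
      using k F.rcos_eq_iff[OF P(3) \<alpha>_closed[OF x]] s(1) HsF by blast
    then have "\<alpha> x \<otimes>\<^bsub>F\<^esub> inv\<^bsub>F\<^esub> s \<otimes>\<^bsub>F\<^esub> s \<in> H"
      using s(1) by (rule subgroup.m_closed[OF HF(1)])
    moreover have "s \<in> carrier F" using s(1) HsF by blast
    ultimately show ?thesis using \<alpha>_closed[OF x] by (simp add: F.m_assoc)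
  qed
  then have LH: "L \<subseteq> H" using \<alpha>H by blast
  have "h \<in> L" if h: "h \<in> H" for h
  proof (rule perm_level_separates_finitely_generated[OF L])
    show hF: "h \<in> carrier F" using h HsF by blast
    fix k
    obtain y where y: "y \<in> ?C" "profinite_map F h = limit_map y"
      using \<iota>C[OF h] \<Theta> by blast
    have yF: "y \<in> carrier Fhat" using y(1) F.profinite_closure_subset by blast
    obtain s where s: "s \<in> H" "y (P k) = P k #>\<^bsub>F\<^esub> s"
      using C_iff[OF yF] y(1) P(1) by blast
    have sF: "s \<in> carrier F" using s(1) HsF by blast
    have "P k #>\<^bsub>F\<^esub> h = limit_map y (P k)"
      using P(1) by (simp add: profinite_map_def flip: y(2))
    also have "\<dots> = P k #>\<^bsub>F\<^esub> e k s"
      by (rule limit_map_eq[OF yF P(1) subset_refl sF s(2)])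
    also have "\<dots> = P k #>\<^bsub>F\<^esub> \<alpha> s" by (rule e_\<alpha>[OF s(1)])
    finally have "h \<in> P k #>\<^bsub>F\<^esub> \<alpha> s"
      using F.rcos_self[OF hF P(3), of k] by simp
    then show "\<exists>l\<in>L. h \<in> P k #>\<^bsub>F\<^esub> l" using \<alpha>H s(1) by blast
  qed
  with LH show ?thesis by blast
qed

section \<open>Verbal subgroups\<close>

context group
begin

abbreviation verbal_values :: "(nat \<times> bool) list set \<Rightarrow> 'a set" where
  "verbal_values V \<equiv> {h w | h w. h \<in> hom (free_group (UNIV :: nat set)) G \<and> w \<in> V}"

lemma verbal_values_closed:
  assumes "V \<subseteq> carrier (free_group UNIV)"
  shows "verbal_values V \<subseteq> carrier G"
  using assms by (auto simp: hom_def Pi_iff)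

lemma verbal_subgroup_normal:
  assumes "V \<subseteq> carrier (free_group UNIV)"
  shows "verbal_subgroup G V \<lhd> G"
  unfolding verbal_subgroup_def
proof (rule normal_generateI)
  show "verbal_values V \<subseteq> carrier G" using assms by (rule verbal_values_closed)
  fix x g assume "x \<in> verbal_values V" and g: "g \<in> carrier G"
  then obtain h w where h: "h \<in> hom (free_group (UNIV :: nat set)) G" "w \<in> V" "x = h w" by blast
  have "(\<lambda>y. g \<otimes> y \<otimes> inv g) \<in> hom G G"
    using g by (auto simp: hom_def m_assoc inv_solve_left)
  then have "(\<lambda>y. g \<otimes> y \<otimes> inv g) \<circ> h \<in> hom (free_group (UNIV :: nat set)) G"
    by (rule Group.hom_compose[OF h(1)])
  with h(2,3) show "g \<otimes> x \<otimes> inv g \<in> verbal_values V"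
    by (intro CollectI exI[of _ "(\<lambda>y. g \<otimes> y \<otimes> inv g) \<circ> h"] exI[of _ w]) simp
qed

text \<open>Composing \<open>\<phi>\<close> with a substitution gives a substitution in the quotient, which by projectivity
  lifts to one in \<open>G\<close>. So \<open>\<phi>\<close> sends values of words in \<open>V\<close> to the classes of other such values,
  and these are trivial.\<close>

lemma verbal_subgroup_killed:
  assumes V: "V \<subseteq> carrier (free_group UNIV)" and \<phi>: "\<phi> \<in> hom G (G Mod verbal_subgroup G V)"
    and x: "x \<in> verbal_subgroup G V"
  shows "\<phi> x = verbal_subgroup G V"
proof -
  let ?H = "verbal_subgroup G V"
  interpret H: normal ?H G using V by (rule verbal_subgroup_normal)
  interpret \<phi>: group_hom G "G Mod ?H" \<phi>
    by (intro group_hom.intro group_hom_axioms.intro is_group H.factorgroup_is_group \<phi>)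
  have "verbal_values V \<subseteq> kernel G (G Mod ?H) \<phi>"
  proof
    fix y assume y: "y \<in> verbal_values V"
    then obtain h w where h: "h \<in> hom (free_group (UNIV :: nat set)) G" "w \<in> V" "y = h w" by blast
    obtain g where g: "g \<in> hom (free_group (UNIV :: nat set)) G"
      "\<And>u. u \<in> carrier (free_group UNIV) \<Longrightarrow> (\<phi> \<circ> h) u = ?H #> g u"
      using free_group_projective[OF is_group H.normal_axioms Group.hom_compose[OF h(1) \<phi>]] by blast
    have "g w \<in> ?H" unfolding verbal_subgroup_def using g(1) h(2) by (intro generate.incl) blast
    then have "\<phi> y = ?H" using g(2) h V H.rcos_const[OF is_group] by fastforce
    moreover have "y \<in> carrier G" using y verbal_values_closed[OF V] by blast
    ultimately show "y \<in> kernel G (G Mod ?H) \<phi>" by (simp add: kernel_def)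
  qed
  then have "generate G (verbal_values V) \<subseteq> kernel G (G Mod ?H) \<phi>"
    using \<phi>.subgroup_kernel by (rule generate_subgroup_incl)
  with x show ?thesis
    unfolding verbal_subgroup_def[of G V] by (auto simp: kernel_def)
qed

lemma mem_closure_normal_iff:
  assumes H: "H \<in> fin_quotients G" and x: "x \<in> carrier (profinite_completion G)"
  shows "x \<in> profinite_closure G H \<longleftrightarrow> x H = H"
proof -
  have HG: "subgroup H G" "H \<subseteq> carrier G" using fin_quotientsD(2)[OF H] by (auto dest: subgroup.subset)
  show ?thesis unfolding mem_profinite_closure_iff[OF HG(2) x]
  proof
    assume "\<forall>N\<in>fin_quotients G. \<exists>s\<in>H. x N = N #> s"
    then show "x H = H" using H HG coset_join2 by blast
  next
    assume xH: "x H = H"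
    show "\<forall>N\<in>fin_quotients G. \<exists>s\<in>H. x N = N #> s"
    proof
      fix N assume N: "N \<in> fin_quotients G"
      have NH: "N \<inter> H \<in> fin_quotients G" using N H by (rule fin_quotients_Int)
      obtain g where g: "g \<in> carrier G" "x (N \<inter> H) = (N \<inter> H) #> g"
        using profinite_completion_coset[OF x NH] .
      have "H #> g = H" using profinite_completion_mono[OF x NH H _ g] xH by simp
      then have "g \<in> H" using coset_join1 g(1) HG(1) by blast
      moreover have "x N = N #> g" using profinite_completion_mono[OF x NH N _ g] by simp
      ultimately show "\<exists>s\<in>H. x N = N #> s" by blast
    qed
  qed
qed

text \<open>The condition on an element of the completion to agree with \<open>x\<close> at \<open>N\<close>, both before and after
  applying \<open>\<Theta>\<close>, is open, and the image of \<open>G\<close> is dense.\<close>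

lemma continuous_aut_dense:
  assumes \<Theta>: "\<Theta> \<in> continuous_aut G" and N: "N \<in> fin_quotients G"
    and x: "x \<in> carrier (profinite_completion G)"
  obtains g where "g \<in> carrier G" "x N = N #> g" "\<Theta> x N = \<Theta> (profinite_map G g) N"
proof -
  let ?U = "{y \<in> carrier (profinite_completion G). y N = x N}"
  let ?W = "{y \<in> topspace (profinite_topology G). \<Theta> y \<in>
      {z \<in> carrier (profinite_completion G). z N = \<Theta> x N}}"
  have cont: "continuous_map (profinite_topology G) (profinite_topology G) \<Theta>"
    and hom: "\<Theta> \<in> hom (profinite_completion G) (profinite_completion G)"
    using \<Theta> by (auto simp: continuous_aut_def iso_def)
  have "openin (profinite_topology G) (?U \<inter> ?W)"
    by (intro openin_Int openin_profinite_fiber openin_continuous_map_preimage[OF cont] N)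
  moreover have "x \<in> ?U \<inter> ?W" using x hom by (auto simp: topspace_profinite hom_def)
  moreover have "x \<in> profinite_closure G (carrier G)"
    using mem_profinite_closure_iff[OF subset_refl x] profinite_completion_coset[OF x] by metis
  ultimately have "\<exists>y. y \<in> profinite_map G ` carrier G \<and> y \<in> ?U \<inter> ?W"
    unfolding profinite_closure_def in_closure_of by meson
  then obtain g where "g \<in> carrier G" "profinite_map G g \<in> ?U \<inter> ?W" by blast
  then show ?thesis using that N by (auto simp: profinite_map_def)
qed

text \<open>Let \<open>\<Theta>\<close> be a continuous automorphism. The homomorphism \<open>\<phi>\<close> from \<open>G\<close> to its quotient by \<open>H\<close> that is
  given by \<open>\<Theta>\<close> and the coordinate at \<open>H\<close> kills \<open>H\<close>. By density, the coordinate of \<open>\<Theta> x\<close> at \<open>H\<close>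
  is thus a function of the coordinate of \<open>x\<close>. This function is a surjective self-map of a finite
  set, hence injective, so \<open>\<Theta> x\<close> is trivial at \<open>H\<close> if and only if \<open>x\<close> is; and triviality at \<open>H\<close>
  defines the closure of \<open>H\<close>.\<close>

theorem verbal_profinitely_characteristic:
  assumes "is_verbal G H" and fi: "finite_index G H"
  shows "profinitely_characteristic G H"
proof -
  obtain V where V: "V \<subseteq> carrier (free_group UNIV)" "H = verbal_subgroup G V"
    using assms(1) by (auto simp: is_verbal_def)
  interpret H: normal H G unfolding V(2) using V(1) by (rule verbal_subgroup_normal)
  have HQ: "H \<in> fin_quotients G" using fi H.normal_axioms by (simp add: fin_quotients_def)
  have HG: "subgroup H G" by (rule H.subgroup_axioms)
  let ?Gh = "profinite_completion G"
  let ?C = "profinite_closure G H"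
  have "\<Theta> ` ?C = ?C" if \<Theta>: "\<Theta> \<in> continuous_aut G" for \<Theta>
  proof -
    have hom: "\<Theta> \<in> hom ?Gh ?Gh" and onto: "\<Theta> ` carrier ?Gh = carrier ?Gh"
      using \<Theta> by (auto simp: continuous_aut_def iso_def bij_betw_def)
    have closed: "\<Theta> x \<in> carrier ?Gh" if "x \<in> carrier ?Gh" for x using onto that by blast
    define \<phi> where "\<phi> = (\<lambda>g. \<Theta> (profinite_map G g) H)"
    have coord: "(\<lambda>x. x H) \<in> hom ?Gh (G Mod H)"
      using HQ by (auto intro!: homI simp: profinite_completion_def PiE_iff)
    have \<phi>: "\<phi> \<in> hom G (G Mod H)"
      using Group.hom_compose[OF Group.hom_compose[OF profinite_map_hom hom] coord] by (simp add: \<phi>_def comp_def)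
    have \<phi>H: "\<phi> g = H" if "g \<in> H" for g
      using verbal_subgroup_killed[OF V(1)] \<phi> that V(2) by blast
    interpret \<phi>: group_hom G "G Mod H" \<phi>
      by (intro group_hom.intro group_hom_axioms.intro is_group H.factorgroup_is_group \<phi>)
    have \<phi>_cong: "\<phi> g = \<phi> h" if "g \<in> carrier G" "h \<in> carrier G" "H #> g = H #> h" for g h
    proof -
      have "g \<otimes> inv h \<in> H" using that HG by (simp add: rcos_eq_iff)
      then have "\<phi> (g \<otimes> inv h \<otimes> h) = \<phi> h"
        using that \<phi>H \<phi>.hom_mult[of "g \<otimes> inv h" h] \<phi>.H.l_one[of "\<phi> h"] by simp
      then show ?thesis using that by (simp add: m_assoc)
    qed
    have fwd: "\<Theta> x H = \<Theta> y H" if "x \<in> carrier ?Gh" "y \<in> carrier ?Gh" "x H = y H" for x y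
      using continuous_aut_dense[OF \<Theta> HQ that(1)] continuous_aut_dense[OF \<Theta> HQ that(2)] that(3) \<phi>_cong
      unfolding \<phi>_def by metis
    have onto_H: "(\<lambda>x. x H) ` carrier ?Gh = carrier (G Mod H)"
    proof (intro equalityI subsetI)
      fix C assume "C \<in> (\<lambda>x. x H) ` carrier ?Gh"
      then show "C \<in> carrier (G Mod H)" using coord by (auto simp: hom_def)
    next
      fix C assume "C \<in> carrier (G Mod H)"
      then obtain g where "g \<in> carrier G" "C = H #> g" by (auto simp: carrier_FactGroup)
      then show "C \<in> (\<lambda>x. x H) ` carrier ?Gh"
        using HQ by (intro image_eqI[OF _ profinite_map_closed[of g]]) (simp_all add: profinite_map_def)
    qed
    have bwd: "x H = y H" if "x \<in> carrier ?Gh" "y \<in> carrier ?Gh" "\<Theta> x H = \<Theta> y H" for x y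
    proof (rule finite_surj_factor_inj[of "carrier (G Mod H)" "\<lambda>x. x H" "carrier ?Gh" "\<lambda>x. \<Theta> x H"])
      show "finite (carrier (G Mod H))"
        using fin_quotientsD(3)[OF HQ] by (simp add: carrier_FactGroup_rcosets)
      have "(\<lambda>x. \<Theta> x H) ` carrier ?Gh = (\<lambda>x. x H) ` \<Theta> ` carrier ?Gh"
        by (simp add: image_image)
      then show "(\<lambda>x. \<Theta> x H) ` carrier ?Gh = carrier (G Mod H)" using onto onto_H by simp
    qed (fact onto_H fwd that)+
    let ?e = "profinite_map G \<one>"
    have one: "?e \<in> carrier ?Gh" "?e H = H" "\<Theta> ?e H = H"
      using profinite_map_closed HQ \<phi>H[OF H.one_closed] H.subset
      by (simp_all add: profinite_map_def \<phi>_def)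
    have C_iff: "x \<in> ?C \<longleftrightarrow> x \<in> carrier ?Gh \<and> x H = H" for x
      using mem_closure_normal_iff[OF HQ] profinite_closure_subset by blast
    have "\<Theta> x \<in> ?C \<longleftrightarrow> x \<in> ?C" if "x \<in> carrier ?Gh" for x
      using fwd[OF that one(1)] bwd[OF that one(1)] one that closed unfolding C_iff by metis
    then have "\<Theta> ` ?C = \<Theta> ` carrier ?Gh \<inter> ?C"
      using profinite_closure_subset[of H] by blast
    then show ?thesis using onto profinite_closure_subset[of H] by blast
  qed
  then show ?thesis using HG fi by (simp add: profinitely_characteristic_def)
qed

end

theorem theorem4p6:
  fixes n :: nat
  shows "(\<forall>H. subgroup H (free_group_rank n) \<and> finite_index (free_group_rank n) H \<and>
              profinitely_characteristic (free_group_rank n) H \<longrightarrow>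
            (\<forall>L. subgroup L (free_group_rank n) \<and> finitely_generated (free_group_rank n) L \<and>
                 measure_equivalent (free_group_rank n) H L \<longrightarrow> L = H) \<and>
            setwise_profinitely_rigid (free_group_rank n) H) \<and>
         (\<forall>H. is_verbal (free_group_rank n) H \<and> finite_index (free_group_rank n) H \<longrightarrow>
            profinitely_characteristic (free_group_rank n) H)"
proof -
  interpret F: group "free_group_rank n" by (rule group_free_group)
  note rigid = profinitely_characteristic_rigid[OF finite_lessThan[of n]]
  have "\<exists>\<phi>\<in>iso (free_group_rank n) (free_group_rank n). H = \<phi> ` H" for H
    using iso_set_refl by (intro bexI[of _ "\<lambda>x. x"]) auto
  then show ?thesis
    using rigid F.verbal_profinitely_characteristic
    unfolding setwise_profinitely_rigid_def by metis
qed

end
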